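(* Let $\varphi$ and $\psi$ be bounded analytic functions on the open unit disc $\mathbb{U}$. If $\varphi$ is outer and $\psi$ is a nonconstant inner function, then $T_\varphi\not\propto T_\psi$.
   Context: $\mathbb{U}$ is the open unit disc in $\mathbb{C}$ and $H^2$ is the Hardy space of $\mathbb{U}$. For a bounded analytic function $\varphi$ on $\mathbb{U}$, $T_\varphi:H^2\to H^2$ is the analytic Toeplitz operator $T_\varphi h=\varphi h$. For bounded linear operators $A,B$ on a Hilbert space $\mathcal{H}$, $A\propto B$ means that there is a nonzero bounded linear operator $X$ on $\mathcal{H}$ with $XA=BX$; $\not\propto$ is its negation. *)

theory Defs
  imports "HOL-Complex_Analysis.Complex_Analysis"
begin

abbreviation unit_disc :: "complex set" ("\<U>") where
  "\<U> \<equiv> ball 0 1"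

definition bounded_analytic :: "(complex \<Rightarrow> complex) \<Rightarrow> bool" where
  "bounded_analytic \<phi> \<longleftrightarrow> \<phi> holomorphic_on \<U> \<and> bounded (\<phi> ` \<U>)"

definition square_mean :: "(complex \<Rightarrow> complex) \<Rightarrow> real \<Rightarrow> real" where
  "square_mean f r = 1 / (2 * pi) * integral {0..2*pi} (\<lambda>t. (norm (f (of_real r * cis t)))\<^sup>2)"

text \<open>Elements of $H^2$ are functions on the disc; as HOL functions are total, each is represented
  by its extension by zero, so that equality of HOL functions is equality in $H^2$ and the
  pointwise operations do not leave the set of representatives.\<close>

definition hardy2 :: "(complex \<Rightarrow> complex) set" where
  "hardy2 = {f. f holomorphic_on \<U> \<and> (\<forall>z. z \<notin> \<U> \<longrightarrow> f z = 0) \<and> bdd_above (square_mean f ` {0..<1})}"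

definition hardy2_norm :: "(complex \<Rightarrow> complex) \<Rightarrow> real" where
  "hardy2_norm f = sqrt (SUP r\<in>{0..<1}. square_mean f r)"

type_synonym hardy2_map = "(complex \<Rightarrow> complex) \<Rightarrow> complex \<Rightarrow> complex"

definition bounded_operator :: "hardy2_map \<Rightarrow> bool" where
  "bounded_operator X \<longleftrightarrow>
     (\<forall>f\<in>hardy2. X f \<in> hardy2) \<and>
     (\<forall>f\<in>hardy2. \<forall>g\<in>hardy2. X (\<lambda>z. f z + g z) = (\<lambda>z. X f z + X g z)) \<and>
     (\<forall>c. \<forall>f\<in>hardy2. X (\<lambda>z. c * f z) = (\<lambda>z. c * X f z)) \<and>
     (\<exists>C. \<forall>f\<in>hardy2. hardy2_norm (X f) \<le> C * hardy2_norm f)"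

text \<open>Operators on $H^2$ are only considered on \<^const>\<open>hardy2\<close>, so being nonzero and being equal
  are both relative to that set.\<close>

definition intertwined :: "hardy2_map \<Rightarrow> hardy2_map \<Rightarrow> bool" (infix "\<propto>" 50) where
  "A \<propto> B \<longleftrightarrow> (\<exists>X. bounded_operator X \<and> (\<exists>f\<in>hardy2. X f \<noteq> (\<lambda>z. 0)) \<and>
                  (\<forall>f\<in>hardy2. X (A f) = B (X f)))"

definition toeplitz :: "(complex \<Rightarrow> complex) \<Rightarrow> hardy2_map" where
  "toeplitz \<phi> h = (\<lambda>z. \<phi> z * h z)"

definition inner_function :: "(complex \<Rightarrow> complex) \<Rightarrow> bool" where
  "inner_function \<psi> \<longleftrightarrow> bounded_analytic \<psi> \<and>
     (AE t in lborel. t \<in> {0..2*pi} \<longrightarrow>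
        (\<exists>w. norm w = 1 \<and> ((\<lambda>r. \<psi> (of_real r * cis t)) \<longlongrightarrow> w) (at_left 1)))"

text \<open>The classical definition: $\phi = c \exp$ of the Herglotz integral of $\log k$, where $|c| = 1$,
  $k \ge 0$ is measurable and $\log k$ is integrable. Integrability forces $k > 0$ almost everywhere,
  but $\ln 0 = 0$ in HOL, so positivity is required explicitly (a null set does not matter).\<close>

definition outer_function :: "(complex \<Rightarrow> complex) \<Rightarrow> bool" where
  "outer_function \<phi> \<longleftrightarrow> (\<exists>c k. norm c = 1 \<and> k \<in> borel_measurable lborel \<and> (\<forall>t. 0 < k t) \<and>
     set_integrable lborel {0..2*pi} (\<lambda>t. ln (k t)) \<and>
     (\<forall>z\<in>\<U>. \<phi> z = c * exp (1 / (2 * pi) *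
        (LINT t:{0..2*pi}|lborel. (cis t + z) / (cis t - z) * of_real (ln (k t))))))"

lemma square_mean_mult_le:
  assumes f: "f holomorphic_on \<U>" and p: "\<phi> holomorphic_on \<U>"
    and C: "\<And>z. z \<in> \<U> \<Longrightarrow> norm (\<phi> z) \<le> C" and r: "r \<in> {0..<1}"
  shows "square_mean (toeplitz \<phi> f) r \<le> C\<^sup>2 * square_mean f r"
proof -
  have in_disc: "of_real r * cis t \<in> \<U>" for t using r by (simp add: norm_mult)
  have cont: "continuous_on {0..2*pi} (\<lambda>t. g (of_real r * cis t))"
    if "g holomorphic_on \<U>" for g :: "complex \<Rightarrow> complex"
    by (rule continuous_on_compose2[OF holomorphic_on_imp_continuous_on[OF that]])
       (use in_disc in \<open>auto intro!: continuous_intros\<close>)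
  have "integral {0..2*pi} (\<lambda>t. (norm (\<phi> (of_real r * cis t) * f (of_real r * cis t)))\<^sup>2)
     \<le> integral {0..2*pi} (\<lambda>t. C\<^sup>2 * (norm (f (of_real r * cis t)))\<^sup>2)"
    by (intro integral_le integrable_continuous_real continuous_intros cont f p)
       (use C in_disc in \<open>auto simp: norm_mult power_mult_distrib intro!: mult_right_mono power_mono\<close>)
  then show ?thesis
    by (simp add: square_mean_def toeplitz_def divide_right_mono)
qed

lemma bounded_operator_toeplitz:
  assumes "bounded_analytic \<phi>"
  shows "bounded_operator (toeplitz \<phi>)"
proof -
  have p: "\<phi> holomorphic_on \<U>" using assms by (simp add: bounded_analytic_def)
  obtain C where C: "\<And>z. z \<in> \<U> \<Longrightarrow> norm (\<phi> z) \<le> C"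
    using assms unfolding bounded_analytic_def bounded_iff by blast
  have C0: "0 \<le> C" using C[of 0] by (meson centre_in_ball norm_ge_zero order_trans zero_less_one)
  have *: "toeplitz \<phi> f \<in> hardy2 \<and> hardy2_norm (toeplitz \<phi> f) \<le> C * hardy2_norm f"
    if f: "f \<in> hardy2" for f
  proof -
    have fh: "f holomorphic_on \<U>" and bdd: "bdd_above (square_mean f ` {0..<1})"
      using f by (auto simp: hardy2_def)
    have le: "square_mean (toeplitz \<phi> f) r \<le> C\<^sup>2 * (SUP r\<in>{0..<1}. square_mean f r)"
      if "r \<in> {0..<1}" for r
      using square_mean_mult_le[OF fh p C that] cSUP_upper[OF that bdd]
      by (meson mult_left_mono order_trans zero_le_power2)
    have "bdd_above (square_mean (toeplitz \<phi> f) ` {0..<1})"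
      using le by (rule bdd_aboveI2)
    then have "toeplitz \<phi> f \<in> hardy2"
      using f p by (auto simp: hardy2_def toeplitz_def intro!: holomorphic_intros)
    moreover have "(SUP r\<in>{0..<1}. square_mean (toeplitz \<phi> f) r)
        \<le> C\<^sup>2 * (SUP r\<in>{0..<1}. square_mean f r)"
      by (rule cSUP_least) (use le in auto)
    then have "hardy2_norm (toeplitz \<phi> f) \<le> C * hardy2_norm f"
      using C0 by (metis hardy2_norm_def real_sqrt_le_mono real_sqrt_mult real_sqrt_unique)
    ultimately show ?thesis by blast
  qed
  then show ?thesis
    by (auto simp: bounded_operator_def toeplitz_def[abs_def] algebra_simps)
qed

end

theory Submission
  imports Defs
begin

text \<open>Suppose that \<open>X\<close> is bounded and \<open>X T\<^sub>\<phi> = T\<^sub>\<psi> X\<close>, hence \<open>X T\<^sub>\<phi>\<^sup>n = T\<^sub>\<psi>\<^sup>n X\<close> for all \<open>n\<close>. Powers of \<open>\<phi>\<close> are outer,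
  so \<open>T\<^sub>\<phi>\<^sup>n\<close> has dense range; powers of \<open>\<psi>\<close> are inner, so \<open>T\<^sub>\<psi>\<^sup>n\<close> is an isometry and has closed range. Therefore
  \<open>X\<close> maps into every \<open>\<psi>\<^sup>n H\<^sup>2\<close>, and the intersection of these spaces is \<open>{0}\<close>: if \<open>f = \<psi>\<^sup>n g\<close> then \<open>g\<close> has the
  norm of \<open>f\<close>, so \<open>\<bar>f z\<bar> \<le> \<bar>\<psi> z\<bar>\<^sup>n K \<parallel>f\<parallel>\<close> with \<open>K\<close> depending only on \<open>z\<close>, and \<open>\<bar>\<psi> z\<bar> < 1\<close> as \<open>\<psi>\<close> is not
  constant. The lemma \<open>intertwining_point_bound\<close> states the resulting estimate of \<open>X f z\<close> directly.

  Its two ingredients are proved without boundary values of general elements of \<open>H\<^sup>2\<close>. That an inner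
  multiplier does not decrease the norm (\<open>hardy2_norm_inner_mult\<close>) is clear from the radial limits of
  \<open>\<psi>\<close> if the other factor is a dilation \<open>g (\<rho> z)\<close>, and the general case follows since the dilations
  tend to \<open>g\<close>. Density of the range for outer \<open>\<phi>\<close> (\<open>outer_toeplitz_dense_range\<close>) follows by truncating
  the logarithmic density of \<open>\<phi>\<close>, which gives bounded analytic \<open>h\<^sub>n\<close> with \<open>\<bar>\<phi> h\<^sub>n\<bar> \<le> 1\<close> and \<open>\<phi> h\<^sub>n\<close> tending
  pointwise to \<open>1\<close>. In both cases pointwise convergence is upgraded to norm convergence by
  \<open>hardy2_norm_tendsto_0\<close>, since the approximants do not exceed the limit in norm.\<close>

section \<open>Square means over circles\<close>

lemma in_disc: "0 \<le> r \<Longrightarrow> r < 1 \<Longrightarrow> of_real r * cis t \<in> \<U>"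
  by (simp add: norm_mult)

lemma mult_in_disc:
  fixes z :: complex
  assumes "0 \<le> \<rho>" "\<rho> < 1" "z \<in> \<U>"
  shows "of_real \<rho> * z \<in> \<U>"
  using assms mult_left_le[of \<rho> "norm z"] mult_mono[of \<rho> 1 "norm z" "norm z"] by (simp add: norm_mult)

lemma continuous_on_circle:
  assumes "f holomorphic_on \<U>" "0 \<le> r" "r < 1"
  shows "continuous_on A (\<lambda>t. f (of_real r * cis t))"
  by (rule continuous_on_compose2[OF holomorphic_on_imp_continuous_on[OF assms(1)]])
     (use assms in \<open>auto intro!: continuous_intros simp: norm_mult\<close>)

lemma integrable_square_on_circle:
  assumes "f holomorphic_on \<U>" "0 \<le> r" "r < 1"
  shows "(\<lambda>t. (norm (f (of_real r * cis t)))\<^sup>2) integrable_on {0..2*pi}"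
  by (intro integrable_continuous_real continuous_intros continuous_on_circle assms)

text \<open>Square means are defined by the gauge integral of a continuous function, while the radial limits of an
  inner function exist only almost everywhere; this form of dominated convergence bridges the two.\<close>

lemma integral_tendsto_bounded_AE:
  fixes u :: "nat \<Rightarrow> real \<Rightarrow> real"
  assumes u: "\<And>n. continuous_on {a..b} (u n)" and v: "continuous_on {a..b} v"
    and bound: "\<And>n t. t \<in> {a..b} \<Longrightarrow> \<bar>u n t\<bar> \<le> B"
    and lim: "AE t in lborel. t \<in> {a..b} \<longrightarrow> (\<lambda>n. u n t) \<longlonglongrightarrow> v t"
  shows "(\<lambda>n. integral {a..b} (u n)) \<longlonglongrightarrow> integral {a..b} v"
proof -
  have int: "set_integrable lborel {a..b} h" if "continuous_on {a..b} h" for h :: "real \<Rightarrow> real"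
    using that by (rule borel_integrable_atLeastAtMost')
  have meas: "(\<lambda>t. indicator {a..b} t *\<^sub>R h t) \<in> borel_measurable lborel"
    if "continuous_on {a..b} h" for h :: "real \<Rightarrow> real"
    using int[OF that] by (auto simp: set_integrable_def)
  have "(\<lambda>n. LINT t:{a..b}|lborel. u n t) \<longlonglongrightarrow> (LINT t:{a..b}|lborel. v t)"
    unfolding set_lebesgue_integral_def
  proof (rule integral_dominated_convergence)
    show "integrable lborel (\<lambda>t. indicator {a..b} t *\<^sub>R B)"
      using int[of "\<lambda>_. B"] by (simp add: set_integrable_def)
    show "AE t in lborel. (\<lambda>n. indicator {a..b} t *\<^sub>R u n t) \<longlonglongrightarrow> indicator {a..b} t *\<^sub>R v t"
      using lim by eventually_elim (auto simp: indicator_def)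
    show "AE t in lborel. norm (indicator {a..b} t *\<^sub>R u n t) \<le> indicator {a..b} t *\<^sub>R B" for n
      using bound by (auto simp: indicator_def)
  qed (rule meas[OF v] meas[OF u])+
  then show ?thesis
    by (simp add: set_borel_integral_eq_integral(2)[OF int] u v)
qed

lemma square_mean_tendsto:
  assumes "\<And>n. F n holomorphic_on \<U>" "f holomorphic_on \<U>" "0 \<le> r" "r < 1"
    and "\<And>n z. norm z = r \<Longrightarrow> norm (F n z) \<le> B"
    and "\<And>z. z \<in> \<U> \<Longrightarrow> (\<lambda>n. F n z) \<longlonglongrightarrow> f z"
  shows "(\<lambda>n. square_mean (F n) r) \<longlonglongrightarrow> square_mean f r"
  unfolding square_mean_def
proof (intro tendsto_mult_left integral_tendsto_bounded_AE[where B = "B\<^sup>2"] continuous_intros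
    continuous_on_circle assms)
  fix n t
  show "\<bar>(cmod (F n (of_real r * cis t)))\<^sup>2\<bar> \<le> B\<^sup>2"
    using assms(3) assms(5)[of "of_real r * cis t" n] by (simp add: norm_mult power_mono)
qed (use assms in_disc in \<open>auto intro!: AE_I2 tendsto_intros\<close>)

lemma has_integral_cis_int:
  "((\<lambda>t. cis (of_int m * t)) has_integral (if m = 0 then 2 * pi else 0)) {0..2*pi}"
proof (cases "m = 0")
  case True
  then show ?thesis using has_integral_const_real[of "1::complex" 0 "2*pi"]
    by (simp add: scaleR_conv_of_real)
next
  case False
  have "((\<lambda>t. cis (of_int m * t)) has_integral
      (cis (of_int m * (2*pi)) / (\<i> * of_int m) - cis (of_int m * 0) / (\<i> * of_int m))) {0..2*pi}"
  proof (rule fundamental_theorem_of_calculus)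
    fix t :: real
    have "((\<lambda>w. exp (\<i> * (of_int m * w)) / (\<i> * of_int m)) has_field_derivative
        exp (\<i> * (of_int m * of_real t))) (at (of_real t))"
      using False by (auto intro!: derivative_eq_intros simp: field_simps)
    then have "((\<lambda>t. exp (\<i> * (of_int m * of_real t)) / (\<i> * of_int m)) has_vector_derivative
        exp (\<i> * (of_int m * of_real t))) (at t within {0..2*pi})"
      by (rule has_vector_derivative_real_field)
    then show "((\<lambda>t. cis (of_int m * t) / (\<i> * of_int m)) has_vector_derivative
        cis (of_int m * t)) (at t within {0..2*pi})"
      by (simp add: cis_conv_exp)
  qed simp
  moreover have "cis (of_int m * (2*pi)) = 1"
    using cis_multiple_2pi[of "of_int m"] by (simp add: mult.commute mult.left_commute)
  ultimately show ?thesis using False by simp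
qed

text \<open>Expanding the square leaves only the diagonal terms, by orthogonality of the characters.\<close>

lemma square_mean_polynomial:
  assumes "0 \<le> r"
  shows "square_mean (\<lambda>z. \<Sum>j<n. a j * z ^ j) r = (\<Sum>j<n. (norm (a j))\<^sup>2 * r ^ (2 * j))"
proof -
  let ?p = "\<lambda>t. \<Sum>j<n. a j * (of_real r * cis t) ^ j"
  let ?b = "\<lambda>j k. a j * cnj (a k) * of_real (r ^ (j + k))"
  have eq: "complex_of_real ((norm (?p t))\<^sup>2) = (\<Sum>j<n. \<Sum>k<n. ?b j k * cis (of_int (int j - int k) * t))" for t
  proof -
    have "cis (of_int (int j - int k) * t) = cis t ^ j * cnj (cis t ^ k)" for j k
      by (simp add: Complex.DeMoivre cis_mult cis_cnj algebra_simps flip: cis_divide)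
    then show ?thesis
      unfolding complex_norm_square
      by (simp add: cnj_sum sum_product power_mult_distrib power_add mult_ac
          del: of_int_diff)
  qed
  have "((\<lambda>t. \<Sum>j<n. \<Sum>k<n. ?b j k * cis (of_int (int j - int k) * t)) has_integral
      (\<Sum>j<n. \<Sum>k<n. ?b j k * (if int j - int k = 0 then 2 * pi else 0))) {0..2*pi}"
    by (intro has_integral_sum has_integral_mult_right has_integral_cis_int) auto
  moreover have "(\<Sum>j<n. \<Sum>k<n. ?b j k * (if int j - int k = 0 then 2 * pi else 0))
      = complex_of_real (2 * pi * (\<Sum>j<n. (norm (a j))\<^sup>2 * r ^ (2 * j)))"
  proof -
    have "?b j j = of_real ((norm (a j))\<^sup>2 * r ^ (2 * j))" for j
      unfolding of_real_mult complex_norm_square by (simp add: mult_2)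
    moreover have "(\<Sum>k<n. ?b j k * (if int j - int k = 0 then 2 * pi else 0)) = ?b j j * (2 * pi)"
      if "j < n" for j
      using that by (subst sum.remove[of _ j]) (auto intro!: sum.neutral)
    ultimately have "(\<Sum>k<n. ?b j k * (if int j - int k = 0 then 2 * pi else 0))
        = of_real (2 * pi * ((norm (a j))\<^sup>2 * r ^ (2 * j)))" if "j < n" for j
      using that by simp
    then show ?thesis
      unfolding sum_distrib_left of_real_sum by (intro sum.cong refl) auto
  qed
  ultimately have "((\<lambda>t. complex_of_real ((norm (?p t))\<^sup>2)) has_integral
      complex_of_real (2 * pi * (\<Sum>j<n. (norm (a j))\<^sup>2 * r ^ (2 * j)))) {0..2*pi}"
    unfolding eq by simp
  from has_integral_Re[OF this]
  have "((\<lambda>t. (norm (?p t))\<^sup>2) has_integral (2 * pi * (\<Sum>j<n. (norm (a j))\<^sup>2 * r ^ (2 * j)))) {0..2*pi}"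
    by (simp only: Re_complex_of_real)
  then show ?thesis
    by (simp add: square_mean_def integral_unique)
qed

text \<open>Passing to the limit in the identity for Taylor polynomials.\<close>

lemma parseval_circle:
  assumes f: "f holomorphic_on \<U>" and r: "0 \<le> r" "r < 1"
  defines "a \<equiv> \<lambda>j. (deriv ^^ j) f 0 / fact j"
  shows "(\<lambda>j. (norm (a j))\<^sup>2 * r ^ (2 * j)) sums square_mean f r"
proof -
  have pow: "(\<lambda>j. a j * z ^ j) sums f z" if "z \<in> \<U>" for z
    using holomorphic_power_series[OF f that] by (simp add: a_def)
  (* The power series converges at the larger radius s, hence absolutely on the circle of radius r. *)
  define s where "s = (1 + r) / 2"
  have s: "0 \<le> s" "r < s" "s < 1" using r by (auto simp: s_def)
  have "summable (\<lambda>j. norm (a j * of_real r ^ j))"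
    by (rule powser_insidea[of _ "complex_of_real s"])
       (use r s pow[of "of_real s"] in \<open>auto simp: sums_iff\<close>)
  then have summ: "summable (\<lambda>j. norm (a j) * r ^ j)"
    using r by (simp add: norm_mult norm_power)
  have "(\<lambda>n. square_mean (\<lambda>z. \<Sum>j<n. a j * z ^ j) r) \<longlonglongrightarrow> square_mean f r"
  proof (rule square_mean_tendsto[where B = "\<Sum>j. norm (a j) * r ^ j"])
    fix n and z :: complex assume z: "norm z = r"
    have "norm (\<Sum>j<n. a j * z ^ j) \<le> (\<Sum>j<n. norm (a j) * r ^ j)"
      by (rule sum_norm_le) (simp add: norm_mult norm_power z)
    also have "\<dots> \<le> (\<Sum>j. norm (a j) * r ^ j)"
      using r by (intro sum_le_suminf summ) auto
    finally show "norm (\<Sum>j<n. a j * z ^ j) \<le> (\<Sum>j. norm (a j) * r ^ j)" .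
  qed (use f r pow in \<open>auto simp: sums_def intro!: holomorphic_intros\<close>)
  then show ?thesis
    using r by (simp add: sums_def square_mean_polynomial)
qed

lemma square_mean_nonneg: "0 \<le> square_mean f r"
proof -
  have "0 \<le> integral {0..2*pi} (\<lambda>t. (norm (f (of_real r * cis t)))\<^sup>2)"
    by (cases "(\<lambda>t. (norm (f (of_real r * cis t)))\<^sup>2) integrable_on {0..2*pi}")
       (auto intro!: Henstock_Kurzweil_Integration.integral_nonneg simp: not_integrable_integral)
  then show ?thesis by (simp add: square_mean_def)
qed

lemma square_mean_mono:
  assumes f: "f holomorphic_on \<U>" and "0 \<le> r" "r \<le> s" "s < 1"
  shows "square_mean f r \<le> square_mean f s"
  by (rule sums_le[OF _ parseval_circle[OF f] parseval_circle[OF f]])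
     (use assms in \<open>auto intro!: mult_left_mono power_mono\<close>)

text \<open>The Cauchy--Schwarz inequality for the Taylor series, written as
  \<open>(a j * r ^ j) * (z / r) ^ j\<close>: the first factors are square-summable by Parseval, the second ones
  are dominated by a geometric series.\<close>

lemma square_mean_point_bound:
  assumes \<rho>: "0 \<le> \<rho>" "\<rho> < r" and r: "r < 1"
  shows "\<exists>K\<ge>0. \<forall>f z. f holomorphic_on \<U> \<longrightarrow> norm z \<le> \<rho> \<longrightarrow> (norm (f z))\<^sup>2 \<le> K * square_mean f r"
proof -
  define q where "q = (\<rho> / r)\<^sup>2"
  have r0: "0 < r" using \<rho> by linarith
  have q: "0 \<le> q" "q < 1"
    using \<rho> r0 by (auto simp: q_def power_less_one_iff abs_square_less_1)
  have "(norm (f z))\<^sup>2 \<le> 1 / (1 - q) * square_mean f r" if f: "f holomorphic_on \<U>" and z: "norm z \<le> \<rho>" for f z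
  proof -
    define a where "a = (\<lambda>j. (deriv ^^ j) f 0 / fact j)"
    have "(\<lambda>j. a j * z ^ j) sums f z"
      using holomorphic_power_series[OF f, of z] z \<rho> r by (simp add: a_def)
    then have lim: "(\<lambda>n. (norm (\<Sum>j<n. a j * z ^ j))\<^sup>2) \<longlonglongrightarrow> (norm (f z))\<^sup>2"
      unfolding sums_def by (intro tendsto_intros)
    have par: "(\<lambda>j. (norm (a j))\<^sup>2 * r ^ (2 * j)) sums square_mean f r"
      unfolding a_def using parseval_circle[OF f] r0 r by simp
    have "(norm (\<Sum>j<n. a j * z ^ j))\<^sup>2 \<le> 1 / (1 - q) * square_mean f r" for n
    proof -
      have "norm (\<Sum>j<n. a j * z ^ j) \<le> (\<Sum>j<n. (norm (a j) * r ^ j) * (\<rho> / r) ^ j)"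
        by (rule sum_norm_le)
           (use r0 z in \<open>auto simp: norm_mult norm_power power_divide intro!: mult_left_mono power_mono\<close>)
      then have "(norm (\<Sum>j<n. a j * z ^ j))\<^sup>2 \<le> (\<Sum>j<n. (norm (a j) * r ^ j) * (\<rho> / r) ^ j)\<^sup>2"
        by (intro power_mono) auto
      also have "\<dots> \<le> (\<Sum>j<n. (norm (a j) * r ^ j)\<^sup>2) * (\<Sum>j<n. ((\<rho> / r) ^ j)\<^sup>2)"
        by (rule Cauchy_Schwarz_ineq_sum)
      also have "\<dots> = (\<Sum>j<n. (norm (a j))\<^sup>2 * r ^ (2 * j)) * (\<Sum>j<n. q ^ j)"
        by (simp add: power_mult_distrib q_def power_mult[symmetric] mult.commute)
      also have "\<dots> \<le> square_mean f r * (1 / (1 - q))"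
      proof (rule mult_mono)
        show "(\<Sum>j<n. (norm (a j))\<^sup>2 * r ^ (2 * j)) \<le> square_mean f r"
          using sum_le_suminf[OF sums_summable[OF par], of "{..<n}"] r0 sums_unique[OF par] by simp
        show "(\<Sum>j<n. q ^ j) \<le> 1 / (1 - q)"
          using sum_le_suminf[OF summable_geometric, of q "{..<n}"] q suminf_geometric[of q] by simp
        show "0 \<le> square_mean f r"
          using sums_le[OF _ sums_zero par] r0 by simp
      qed (use q in \<open>auto intro: sum_nonneg\<close>)
      finally show ?thesis by (simp add: mult.commute)
    qed
    then show ?thesis by (intro LIMSEQ_le_const2[OF lim]) auto
  qed
  then show ?thesis using q by (intro exI[of _ "1 / (1 - q)"]) auto
qed

lemma square_mean_cong:
  assumes "\<And>z. z \<in> \<U> \<Longrightarrow> f z = g z" "0 \<le> r" "r < 1"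
  shows "square_mean f r = square_mean g r"
  unfolding square_mean_def using assms(1)[OF in_disc[OF assms(2,3)]] by simp

text \<open>Stated at a single radius. Since the square means increase with the radius, it serves as the
  parallelogram law for the supremum in \<^const>\<open>hardy2_norm\<close> as well.\<close>

lemma parallelogram_square_mean:
  assumes f: "f holomorphic_on \<U>" and g: "g holomorphic_on \<U>" and r: "0 \<le> r" "r < 1"
  shows "square_mean (\<lambda>z. f z + g z) r + square_mean (\<lambda>z. f z - g z) r
    = 2 * square_mean f r + 2 * square_mean g r"
proof -
  have int: "(\<lambda>t. (norm (h (of_real r * cis t)))\<^sup>2) integrable_on {0..2*pi}"
    if "h holomorphic_on \<U>" for h :: "complex \<Rightarrow> complex"
    by (rule integrable_square_on_circle[OF that r])
  have "integral {0..2*pi} (\<lambda>t. (norm (f (of_real r * cis t) + g (of_real r * cis t)))\<^sup>2)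
      + integral {0..2*pi} (\<lambda>t. (norm (f (of_real r * cis t) - g (of_real r * cis t)))\<^sup>2)
    = integral {0..2*pi} (\<lambda>t. (norm (f (of_real r * cis t) + g (of_real r * cis t)))\<^sup>2
        + (norm (f (of_real r * cis t) - g (of_real r * cis t)))\<^sup>2)"
    by (intro Henstock_Kurzweil_Integration.integral_add[symmetric] int[of "\<lambda>z. f z + g z"] int[of "\<lambda>z. f z - g z"]
        holomorphic_intros f g)
  also have "\<dots> = integral {0..2*pi} (\<lambda>t. 2 * (norm (f (of_real r * cis t)))\<^sup>2
      + 2 * (norm (g (of_real r * cis t)))\<^sup>2)"
  proof (rule integral_cong)
    have "(norm (a + b))\<^sup>2 + (norm (a - b))\<^sup>2 = 2 * (norm a)\<^sup>2 + 2 * (norm b)\<^sup>2" for a b :: complex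
      unfolding cmod_power2 by (simp add: power2_eq_square algebra_simps)
    then show "(norm (f (of_real r * cis t) + g (of_real r * cis t)))\<^sup>2
        + (norm (f (of_real r * cis t) - g (of_real r * cis t)))\<^sup>2
      = 2 * (norm (f (of_real r * cis t)))\<^sup>2 + 2 * (norm (g (of_real r * cis t)))\<^sup>2" for t .
  qed
  also have "\<dots> = 2 * integral {0..2*pi} (\<lambda>t. (norm (f (of_real r * cis t)))\<^sup>2)
      + 2 * integral {0..2*pi} (\<lambda>t. (norm (g (of_real r * cis t)))\<^sup>2)"
    by (subst Henstock_Kurzweil_Integration.integral_add) (auto intro!: integrable_on_mult_right int f g)
  finally show ?thesis
    unfolding square_mean_def distrib_left[symmetric] by (simp add: algebra_simps)
qed

text \<open>A substitute for the triangle inequality: if the second mean and afterwards \<open>e\<close> tend to \<open>0\<close>, the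
  first mean keeps the constant \<open>1\<close>.\<close>

lemma square_mean_add_le:
  assumes f: "f holomorphic_on \<U>" and g: "g holomorphic_on \<U>" and r: "0 \<le> r" "r < 1" and e: "0 < e"
  shows "square_mean (\<lambda>z. f z + g z) r \<le> (1 + e) * square_mean f r + (1 + 1 / e) * square_mean g r"
proof -
  have int: "(\<lambda>t. (norm (h (of_real r * cis t)))\<^sup>2) integrable_on {0..2*pi}"
    if "h holomorphic_on \<U>" for h :: "complex \<Rightarrow> complex"
    by (rule integrable_square_on_circle[OF that r])
  have young: "(norm (a + b))\<^sup>2 \<le> (1 + e) * (norm a)\<^sup>2 + (1 + 1 / e) * (norm b)\<^sup>2" for a b :: complex
  proof -
    have "(norm (a + b))\<^sup>2 \<le> (norm a + norm b)\<^sup>2"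
      by (intro power_mono norm_triangle_ineq norm_ge_zero)
    (* The added term cancels the mixed product. *)
    also have "\<dots> \<le> (norm a + norm b)\<^sup>2 + (e * norm a - norm b)\<^sup>2 / e"
      using e by simp
    also have "\<dots> = (1 + e) * (norm a)\<^sup>2 + (1 + 1 / e) * (norm b)\<^sup>2"
      using e by (simp add: power2_eq_square field_simps)
    finally show ?thesis .
  qed
  have "integral {0..2*pi} (\<lambda>t. (norm (f (of_real r * cis t) + g (of_real r * cis t)))\<^sup>2)
    \<le> integral {0..2*pi} (\<lambda>t. (1 + e) * (norm (f (of_real r * cis t)))\<^sup>2
        + (1 + 1 / e) * (norm (g (of_real r * cis t)))\<^sup>2)"
    by (intro integral_le young int[of "\<lambda>z. f z + g z"] integrable_add integrable_on_mult_right int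
        holomorphic_intros f g)
  also have "\<dots> = (1 + e) * integral {0..2*pi} (\<lambda>t. (norm (f (of_real r * cis t)))\<^sup>2)
      + (1 + 1 / e) * integral {0..2*pi} (\<lambda>t. (norm (g (of_real r * cis t)))\<^sup>2)"
    by (simp only: Henstock_Kurzweil_Integration.integral_mult_right
        Henstock_Kurzweil_Integration.integral_add[OF integrable_on_mult_right[OF int[OF f]]
          integrable_on_mult_right[OF int[OF g]]])
  finally have "1 / (2 * pi) * integral {0..2*pi} (\<lambda>t. (norm (f (of_real r * cis t) + g (of_real r * cis t)))\<^sup>2)
    \<le> 1 / (2 * pi) * ((1 + e) * integral {0..2*pi} (\<lambda>t. (norm (f (of_real r * cis t)))\<^sup>2)
      + (1 + 1 / e) * integral {0..2*pi} (\<lambda>t. (norm (g (of_real r * cis t)))\<^sup>2))"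
    by (intro mult_left_mono) auto
  then show ?thesis
    unfolding square_mean_def distrib_left mult.left_commute[of "1 / (2 * pi)"] .
qed

section \<open>Norm and convergence in the Hardy space\<close>

lemma hardy2_holomorphic: "f \<in> hardy2 \<Longrightarrow> f holomorphic_on \<U>"
  by (simp add: hardy2_def)

lemma square_mean_le_hardy2_norm:
  assumes "f \<in> hardy2" "0 \<le> r" "r < 1"
  shows "square_mean f r \<le> (hardy2_norm f)\<^sup>2"
proof -
  have "square_mean f r \<le> (SUP r\<in>{0..<1}. square_mean f r)"
    by (rule cSUP_upper) (use assms in \<open>auto simp: hardy2_def\<close>)
  moreover from this have "0 \<le> (SUP r\<in>{0..<1}. square_mean f r)"
    using square_mean_nonneg[of f r] by linarith
  ultimately show ?thesis by (simp add: hardy2_norm_def)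
qed

lemma hardy2_norm_nonneg: "f \<in> hardy2 \<Longrightarrow> 0 \<le> hardy2_norm f"
  using square_mean_le_hardy2_norm[of f 0] square_mean_nonneg[of f 0] unfolding hardy2_norm_def
  by (metis (no_types, lifting) atLeastLessThan_iff cSUP_upper hardy2_def mem_Collect_eq order.refl order.trans
      real_sqrt_ge_zero zero_less_one)

lemma hardy2_norm_square_le:
  assumes "f \<in> hardy2" and "\<And>r. 0 \<le> r \<Longrightarrow> r < 1 \<Longrightarrow> square_mean f r \<le> B"
  shows "(hardy2_norm f)\<^sup>2 \<le> B"
proof -
  have "(SUP r\<in>{0..<1}. square_mean f r) \<le> B"
    by (rule cSUP_least) (use assms in auto)
  moreover have "0 \<le> (SUP r\<in>{0..<1}. square_mean f r)"
    using hardy2_norm_nonneg[OF assms(1)] by (simp add: hardy2_norm_def)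
  ultimately show ?thesis by (simp add: hardy2_norm_def)
qed

lemma hardy2_norm_square_gt:
  assumes "f \<in> hardy2" and "B < (hardy2_norm f)\<^sup>2"
  obtains r where "0 \<le> r" "r < 1" "B < square_mean f r"
  using hardy2_norm_square_le[OF assms(1), of B] assms(2) by force

lemma hardy2I:
  assumes "f holomorphic_on \<U>" "\<And>z. z \<notin> \<U> \<Longrightarrow> f z = 0"
    and "\<And>r. 0 \<le> r \<Longrightarrow> r < 1 \<Longrightarrow> square_mean f r \<le> B"
  shows "f \<in> hardy2"
  using assms by (auto simp: hardy2_def intro!: bdd_aboveI2)

lemma hardy2_diff:
  assumes "f \<in> hardy2" "g \<in> hardy2"
  shows "(\<lambda>z. f z - g z) \<in> hardy2"
proof (rule hardy2I)
  fix r :: real assume r: "0 \<le> r" "r < 1"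
  show "square_mean (\<lambda>z. f z - g z) r \<le> 2 * (hardy2_norm f)\<^sup>2 + 2 * (hardy2_norm g)\<^sup>2"
    using parallelogram_square_mean[OF assms[THEN hardy2_holomorphic] r]
      square_mean_nonneg[of "\<lambda>z. f z + g z" r] assms[THEN square_mean_le_hardy2_norm, OF r] by linarith
qed (use assms in \<open>auto simp: hardy2_def intro!: holomorphic_intros\<close>)

lemma hardy2_point_bound:
  assumes "z \<in> \<U>"
  obtains K where "0 \<le> K" "\<And>f. f \<in> hardy2 \<Longrightarrow> norm (f z) \<le> K * hardy2_norm f"
proof -
  define r where "r = (1 + norm z) / 2"
  have r: "norm z < r" "r < 1" "0 \<le> r" using assms by (auto simp: r_def)
  obtain K where K: "0 \<le> K"
    and pt: "\<And>f. f holomorphic_on \<U> \<Longrightarrow> (norm (f z))\<^sup>2 \<le> K * square_mean f r"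
    using square_mean_point_bound[OF norm_ge_zero r(1,2)] by auto
  show ?thesis
  proof
    fix f assume f: "f \<in> hardy2"
    have "(norm (f z))\<^sup>2 \<le> K * (hardy2_norm f)\<^sup>2"
      using pt[OF hardy2_holomorphic[OF f]] mult_left_mono[OF square_mean_le_hardy2_norm[OF f r(3,2)] K]
      by linarith
    also have "\<dots> = (sqrt K * hardy2_norm f)\<^sup>2" using K by (simp add: power_mult_distrib)
    finally show "norm (f z) \<le> sqrt K * hardy2_norm f"
      by (rule power2_le_imp_le) (use K hardy2_norm_nonneg[OF f] in auto)
  qed (use K in simp)
qed

text \<open>In a Hilbert space, weak convergence together with norms not exceeding that of the limit gives
  norm convergence. Here pointwise convergence on the disc replaces weak convergence, and the
  parallelogram law gives the conclusion: \<open>\<parallel>F n - f\<parallel>\<^sup>2\<close> is at most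
  \<open>4 * \<parallel>f\<parallel>\<^sup>2 - \<parallel>F n + f\<parallel>\<^sup>2\<close>, and \<open>\<parallel>F n + f\<parallel>\<close> is eventually almost \<open>2 * \<parallel>f\<parallel>\<close>.\<close>

lemma hardy2_norm_tendsto_0:
  assumes F: "\<And>n. F n \<in> hardy2" and f: "f \<in> hardy2"
    and le: "\<And>n. hardy2_norm (F n) \<le> hardy2_norm f"
    and lim: "\<And>z. z \<in> \<U> \<Longrightarrow> (\<lambda>n. F n z) \<longlonglongrightarrow> f z"
  shows "(\<lambda>n. hardy2_norm (\<lambda>z. F n z - f z)) \<longlonglongrightarrow> 0"
proof -
  let ?L = "(hardy2_norm f)\<^sup>2"
  have Fle: "square_mean (F n) r \<le> ?L" if "0 \<le> r" "r < 1" for n r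
    using square_mean_le_hardy2_norm[OF F that] power_mono[OF le hardy2_norm_nonneg[OF F], of n 2]
    by (meson order_trans)
  have "\<forall>\<^sub>F n in sequentially. (hardy2_norm (\<lambda>z. F n z - f z))\<^sup>2 \<le> 4 * e" if e: "0 < e" for e
  proof -
    (* The circle of radius r already carries all but e of the squared norm of f. On it F n + f
       tends to 2 f, so its square mean there eventually exceeds 4 * (?L - e). *)
    obtain r where r: "0 \<le> r" "r < 1" and large: "?L - e < square_mean f r"
      using hardy2_norm_square_gt[OF f, of "?L - e"] e by auto
    obtain K where K: "0 \<le> K" and
      pt: "\<And>h z. h holomorphic_on \<U> \<Longrightarrow> norm z \<le> r \<Longrightarrow> (norm (h z))\<^sup>2 \<le> K * square_mean h ((1 + r) / 2)"
      using square_mean_point_bound[of r "(1 + r) / 2"] r by auto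
    have bound: "norm (h z) \<le> sqrt (K * ?L)"
      if "h \<in> hardy2" "norm z \<le> r" "square_mean h ((1 + r) / 2) \<le> ?L" for h z
      using pt[OF hardy2_holomorphic[OF that(1)] that(2)] mult_left_mono[OF that(3) K]
      by (intro real_le_rsqrt) linarith
    have "(\<lambda>n. square_mean (\<lambda>z. F n z + f z) r) \<longlonglongrightarrow> square_mean (\<lambda>z. f z + f z) r"
    proof (rule square_mean_tendsto[where B = "sqrt (K * ?L) + sqrt (K * ?L)"])
      fix n and z :: complex assume "norm z = r"
      then show "norm (F n z + f z) \<le> sqrt (K * ?L) + sqrt (K * ?L)"
        using r by (intro norm_triangle_mono bound F f Fle square_mean_le_hardy2_norm) auto
    next
      show "(\<lambda>n. F n z + f z) \<longlonglongrightarrow> f z + f z" if "z \<in> \<U>" for z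
        by (intro tendsto_intros lim that)
    qed (intro r holomorphic_intros hardy2_holomorphic F f)+
    moreover have "square_mean (\<lambda>z. f z + f z) r = 4 * square_mean f r"
      using parallelogram_square_mean[OF f[THEN hardy2_holomorphic] f[THEN hardy2_holomorphic] r]
      by (simp add: square_mean_def)
    ultimately have "\<forall>\<^sub>F n in sequentially. 4 * (?L - e) < square_mean (\<lambda>z. F n z + f z) r"
      using large by (intro order_tendstoD(1)) auto
    then show ?thesis
    proof eventually_elim
      case (elim n)
      show ?case
      proof (rule hardy2_norm_square_le[OF hardy2_diff[OF F f]])
        fix s :: real assume s: "0 \<le> s" "s < 1"
        (* The difference is estimated on the larger of the two circles, and the parallelogram law
           trades it for the sum, whose mean there is at least the one at radius r. *)
        define m where "m = max r s"
        have m: "0 \<le> m" "m < 1" "r \<le> m" "s \<le> m" using r s by (auto simp: m_def)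
        have holo: "F n holomorphic_on \<U>" "f holomorphic_on \<U>"
          using F f by (auto intro: hardy2_holomorphic)
        have "square_mean (\<lambda>z. F n z - f z) s \<le> square_mean (\<lambda>z. F n z - f z) m"
          "square_mean (\<lambda>z. F n z + f z) r \<le> square_mean (\<lambda>z. F n z + f z) m"
          using s r m holo by (auto intro!: square_mean_mono holomorphic_intros)
        then show "square_mean (\<lambda>z. F n z - f z) s \<le> 4 * e"
          using parallelogram_square_mean[OF holo m(1,2)] elim Fle[OF m(1,2), of n]
            square_mean_le_hardy2_norm[OF f m(1,2)] by (simp add: algebra_simps)
      qed
    qed
  qed
  note small = this
  have "(\<lambda>n. (hardy2_norm (\<lambda>z. F n z - f z))\<^sup>2) \<longlonglongrightarrow> 0"
  proof (rule order_tendstoI)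
    fix e :: real assume "0 < e"
    then show "\<forall>\<^sub>F n in sequentially. (hardy2_norm (\<lambda>z. F n z - f z))\<^sup>2 < e"
      using small[of "e / 5"] by (auto elim: eventually_mono)
  next
    fix e :: real assume "e < 0"
    then show "\<forall>\<^sub>F n in sequentially. e < (hardy2_norm (\<lambda>z. F n z - f z))\<^sup>2"
      by (intro always_eventually allI) (meson less_le_trans zero_le_power2)
  qed
  then show ?thesis by simp
qed

section \<open>Bounded operators and multipliers\<close>

lemma toeplitz_hardy2: "bounded_analytic \<phi> \<Longrightarrow> f \<in> hardy2 \<Longrightarrow> toeplitz \<phi> f \<in> hardy2"
  using bounded_operator_toeplitz by (auto simp: bounded_operator_def)

lemma bounded_operator_norm_bound:
  assumes "bounded_operator X"
  obtains C where "0 \<le> C" "\<And>f. f \<in> hardy2 \<Longrightarrow> hardy2_norm (X f) \<le> C * hardy2_norm f"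
proof -
  obtain C where C: "\<And>f. f \<in> hardy2 \<Longrightarrow> hardy2_norm (X f) \<le> C * hardy2_norm f"
    using assms unfolding bounded_operator_def by metis
  show ?thesis
  proof
    fix f assume "f \<in> hardy2"
    then show "hardy2_norm (X f) \<le> max C 0 * hardy2_norm f"
      using C by (meson hardy2_norm_nonneg max.cobounded1 mult_right_mono order_trans)
  qed simp
qed

lemma bounded_operator_diff:
  assumes X: "bounded_operator X" and f: "f \<in> hardy2" and g: "g \<in> hardy2"
  shows "X (\<lambda>z. f z - g z) = (\<lambda>z. X f z - X g z)"
proof -
  have "toeplitz (\<lambda>_. -1) g \<in> hardy2"
    by (rule toeplitz_hardy2[OF _ g]) (auto simp: bounded_analytic_def image_constant_conv)
  then have neg: "(\<lambda>z. (-1) * g z) \<in> hardy2" unfolding toeplitz_def .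
  have "X (\<lambda>z. f z + h z) = (\<lambda>z. X f z + X h z)" if "h \<in> hardy2" for h
    using X f that unfolding bounded_operator_def by blast
  from this[OF neg] have "X (\<lambda>z. f z + (-1) * g z) = (\<lambda>z. X f z + X (\<lambda>z. (-1) * g z) z)" .
  also have "X (\<lambda>z. (-1) * g z) = (\<lambda>z. (-1) * X g z)"
    using X g unfolding bounded_operator_def by blast
  finally show ?thesis by simp
qed

lemma bounded_analytic_power:
  assumes "bounded_analytic \<phi>"
  shows "bounded_analytic (\<lambda>z. \<phi> z ^ n)"
proof -
  obtain C where C: "\<And>z. z \<in> \<U> \<Longrightarrow> norm (\<phi> z) \<le> C"
    using assms unfolding bounded_analytic_def bounded_iff by blast
  have "bounded ((\<lambda>z. \<phi> z ^ n) ` \<U>)"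
    unfolding bounded_iff by (rule exI[of _ "C ^ n"]) (use C in \<open>auto simp: norm_power intro!: power_mono\<close>)
  then show ?thesis
    using assms by (auto simp: bounded_analytic_def intro!: holomorphic_intros)
qed

section \<open>Dilations\<close>

text \<open>The value outside the disc is the one that representatives of elements of \<^const>\<open>hardy2\<close> have.\<close>

definition dilation :: "real \<Rightarrow> (complex \<Rightarrow> complex) \<Rightarrow> complex \<Rightarrow> complex" where
  "dilation \<rho> f z = (if z \<in> \<U> then f (of_real \<rho> * z) else 0)"

lemma square_mean_dilation:
  assumes "0 \<le> \<rho>" "\<rho> < 1" "0 \<le> r" "r < 1"
  shows "square_mean (dilation \<rho> f) r = square_mean f (\<rho> * r)"
  unfolding square_mean_def using in_disc[OF assms(3,4)] by (simp add: dilation_def mult.assoc)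

lemma dilation_hardy2:
  assumes f: "f \<in> hardy2" and \<rho>: "0 \<le> \<rho>" "\<rho> < 1"
  shows "dilation \<rho> f \<in> hardy2" "hardy2_norm (dilation \<rho> f) \<le> hardy2_norm f"
proof -
  have le: "square_mean (dilation \<rho> f) r \<le> (hardy2_norm f)\<^sup>2" if "0 \<le> r" "r < 1" for r
    using that \<rho> mult_mono[of \<rho> 1 r r] by (simp add: square_mean_dilation square_mean_le_hardy2_norm[OF f])
  have "(\<lambda>z. f (of_real \<rho> * z)) holomorphic_on \<U>"
    by (rule holomorphic_on_compose_gen[OF _ hardy2_holomorphic[OF f], unfolded o_def])
       (use mult_in_disc[OF \<rho>] in \<open>auto intro!: holomorphic_intros\<close>)
  then have "dilation \<rho> f holomorphic_on \<U>"
    by (rule holomorphic_transform) (simp add: dilation_def)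
  then show H: "dilation \<rho> f \<in> hardy2"
    by (rule hardy2I[OF _ _ le]) (simp_all add: dilation_def)
  show "hardy2_norm (dilation \<rho> f) \<le> hardy2_norm f"
    by (rule power2_le_imp_le[OF hardy2_norm_square_le[OF H le] hardy2_norm_nonneg[OF f]])
qed

lemma dilation_tendsto:
  assumes f: "f \<in> hardy2" and \<rho>: "\<And>n. 0 \<le> \<rho> n" "\<And>n. \<rho> n < 1" "\<rho> \<longlonglongrightarrow> 1"
  shows "(\<lambda>n. hardy2_norm (\<lambda>z. dilation (\<rho> n) f z - f z)) \<longlonglongrightarrow> 0"
proof (rule hardy2_norm_tendsto_0[OF _ f])
  fix z assume z: "z \<in> \<U>"
  have "(\<lambda>n. f (of_real (\<rho> n) * z)) \<longlonglongrightarrow> f (of_real 1 * z)"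
  proof (rule continuous_on_tendsto_compose[OF holomorphic_on_imp_continuous_on[OF hardy2_holomorphic[OF f]]])
    show "(\<lambda>n. of_real (\<rho> n) * z) \<longlonglongrightarrow> of_real 1 * z"
      by (intro tendsto_intros \<rho>)
  qed (use z mult_in_disc[OF \<rho>(1,2)] in auto)
  then show "(\<lambda>n. dilation (\<rho> n) f z) \<longlonglongrightarrow> f z"
    using z by (simp add: dilation_def)
qed (intro dilation_hardy2 f \<rho>)+

lemma tendsto_one_radii:
  "0 \<le> real n / real (Suc n)" "real n / real (Suc n) < 1" "(\<lambda>n. real n / real (Suc n)) \<longlonglongrightarrow> 1"
  using LIMSEQ_n_over_Suc_n by auto

section \<open>Inner functions\<close>

lemma inner_function_power:
  assumes "inner_function \<psi>"
  shows "inner_function (\<lambda>z. \<psi> z ^ n)"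
  unfolding inner_function_def
proof
  show "bounded_analytic (\<lambda>z. \<psi> z ^ n)"
    using assms by (intro bounded_analytic_power) (simp add: inner_function_def)
  have "AE t in lborel. t \<in> {0..2*pi} \<longrightarrow>
        (\<exists>w. norm w = 1 \<and> ((\<lambda>r. \<psi> (of_real r * cis t)) \<longlongrightarrow> w) (at_left 1))"
    using assms by (simp add: inner_function_def)
  then show "AE t in lborel. t \<in> {0..2*pi} \<longrightarrow>
        (\<exists>w. norm w = 1 \<and> ((\<lambda>r. \<psi> (of_real r * cis t) ^ n) \<longlongrightarrow> w) (at_left 1))"
  proof eventually_elim
    case (elim t)
    show ?case
    proof
      assume "t \<in> {0..2*pi}"
      with elim obtain w where "norm w = 1" "((\<lambda>r. \<psi> (of_real r * cis t)) \<longlongrightarrow> w) (at_left 1)"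
        by blast
      then show "\<exists>w. norm w = 1 \<and> ((\<lambda>r. \<psi> (of_real r * cis t) ^ n) \<longlongrightarrow> w) (at_left 1)"
        by (intro exI[of _ "w ^ n"]) (auto simp: norm_power intro!: tendsto_intros)
    qed
  qed
qed

text \<open>Dominated convergence. The dilation by \<open>\<rho> < 1\<close> makes the second factor continuous up to the unit
  circle, so that only the radial limits of the inner function are involved.\<close>

lemma inner_square_mean_tendsto:
  assumes \<psi>: "inner_function \<psi>" and h: "h holomorphic_on \<U>" and \<rho>: "0 \<le> \<rho>" "\<rho> < 1"
    and r: "\<And>n. 0 \<le> r n" "\<And>n. r n < 1" "r \<longlonglongrightarrow> 1"
  shows "(\<lambda>n. square_mean (\<lambda>z. \<psi> z * h (of_real \<rho> * z)) (r n)) \<longlonglongrightarrow> square_mean h \<rho>"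
proof -
  obtain C where C: "\<And>z. z \<in> \<U> \<Longrightarrow> norm (\<psi> z) \<le> C"
    using \<psi> unfolding inner_function_def bounded_analytic_def bounded_iff by blast
  have \<psi>h: "\<psi> holomorphic_on \<U>"
    using \<psi> by (simp add: inner_function_def bounded_analytic_def)
  have cont: "continuous_on (cball 0 \<rho>) h"
    using h \<rho> by (intro continuous_on_subset[OF holomorphic_on_imp_continuous_on]) auto
  have "bounded (h ` cball 0 \<rho>)"
    by (intro compact_imp_bounded compact_continuous_image cont compact_cball)
  then obtain D where D: "\<And>z. norm z \<le> \<rho> \<Longrightarrow> norm (h z) \<le> D"
    unfolding bounded_iff by (metis imageI mem_cball_0)
  have small: "norm (of_real \<rho> * (of_real (r n) * cis t)) \<le> \<rho>" for n t
    using r(1,2)[of n] \<rho> by (simp add: norm_mult mult_left_le)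
  have at_left: "filterlim r (at_left 1) sequentially"
    using r by (auto simp: filterlim_at less_imp_neq[OF r(2)])
  show ?thesis
    unfolding square_mean_def
  proof (intro tendsto_mult_left integral_tendsto_bounded_AE[where B = "(C * D)\<^sup>2"])
    fix n
    have "continuous_on {0..2*pi} (\<lambda>t. h (of_real (\<rho> * r n) * cis t))"
      using \<rho> r(1,2)[of n] mult_left_le[of "r n" \<rho>] by (intro continuous_on_circle h) auto
    then have "continuous_on {0..2*pi} (\<lambda>t. h (of_real \<rho> * (of_real (r n) * cis t)))"
      by (simp add: mult.assoc)
    then show "continuous_on {0..2*pi}
        (\<lambda>t. (norm (\<psi> (of_real (r n) * cis t) * h (of_real \<rho> * (of_real (r n) * cis t))))\<^sup>2)"
      by (intro continuous_intros continuous_on_circle[OF \<psi>h] r)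
  next
    show "continuous_on {0..2*pi} (\<lambda>t. (norm (h (of_real \<rho> * cis t)))\<^sup>2)"
      by (intro continuous_intros continuous_on_circle h \<rho>)
  next
    fix n t
    have "norm (\<psi> (of_real (r n) * cis t) * h (of_real \<rho> * (of_real (r n) * cis t))) \<le> C * D"
      unfolding norm_mult
      using C[OF in_disc[OF r(1,2)]] D[OF small] order_trans[OF norm_ge_zero C[OF in_disc[OF r(1,2)]]]
      by (intro mult_mono) auto
    then show "\<bar>(norm (\<psi> (of_real (r n) * cis t) * h (of_real \<rho> * (of_real (r n) * cis t))))\<^sup>2\<bar>
        \<le> (C * D)\<^sup>2"
      by (simp add: power_mono)
  next
    have "AE t in lborel. t \<in> {0..2*pi} \<longrightarrow>
        (\<exists>w. norm w = 1 \<and> ((\<lambda>r. \<psi> (of_real r * cis t)) \<longlongrightarrow> w) (at_left 1))"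
      using \<psi> by (simp add: inner_function_def)
    then show "AE t in lborel. t \<in> {0..2*pi} \<longrightarrow>
      (\<lambda>n. (norm (\<psi> (of_real (r n) * cis t) * h (of_real \<rho> * (of_real (r n) * cis t))))\<^sup>2)
        \<longlonglongrightarrow> (norm (h (of_real \<rho> * cis t)))\<^sup>2"
    proof eventually_elim
      case (elim t)
      show ?case
      proof
        assume "t \<in> {0..2*pi}"
        with elim obtain w where w: "norm w = 1"
          and lim: "((\<lambda>r. \<psi> (of_real r * cis t)) \<longlongrightarrow> w) (at_left 1)"
          by blast
        have "(\<lambda>n. \<psi> (of_real (r n) * cis t)) \<longlonglongrightarrow> w"
          using filterlim_compose[OF lim at_left] .
        moreover have "(\<lambda>n. h (of_real \<rho> * (of_real (r n) * cis t))) \<longlonglongrightarrow> h (of_real \<rho> * (of_real 1 * cis t))"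
        proof (rule continuous_on_tendsto_compose[OF cont])
          show "(\<lambda>n. of_real \<rho> * (of_real (r n) * cis t)) \<longlonglongrightarrow> of_real \<rho> * (of_real 1 * cis t)"
            by (intro tendsto_intros r)
        qed (use small \<rho> in \<open>auto simp: norm_mult\<close>)
        ultimately have "(\<lambda>n. (norm (\<psi> (of_real (r n) * cis t) * h (of_real \<rho> * (of_real (r n) * cis t))))\<^sup>2)
            \<longlonglongrightarrow> (norm (w * h (of_real \<rho> * (of_real 1 * cis t))))\<^sup>2"
          by (intro tendsto_intros)
        then show "(\<lambda>n. (norm (\<psi> (of_real (r n) * cis t) * h (of_real \<rho> * (of_real (r n) * cis t))))\<^sup>2)
            \<longlonglongrightarrow> (norm (h (of_real \<rho> * cis t)))\<^sup>2"
          by (simp add: norm_mult w)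
      qed
    qed
  qed
qed

text \<open>The definition of an inner function bounds it on the disc only by some constant. The sharp bound
  comes from applying the point evaluation bound to high powers.\<close>

lemma inner_function_norm_le_1:
  assumes \<psi>: "inner_function \<psi>" and z: "z \<in> \<U>"
  shows "norm (\<psi> z) \<le> 1"
proof (rule ccontr)
  assume "\<not> norm (\<psi> z) \<le> 1"
  then have big: "1 < (norm (\<psi> z))\<^sup>2" by (simp add: one_less_power)
  define r where "r = (1 + norm z) / 2"
  have r: "norm z < r" "r < 1" using z by (auto simp: r_def)
  obtain K where K: "0 \<le> K"
    and pt: "\<And>f. f holomorphic_on \<U> \<Longrightarrow> (norm (f z))\<^sup>2 \<le> K * square_mean f r"
    using square_mean_point_bound[OF norm_ge_zero r] by auto
  (* Every power of an inner function is inner, with mean squares at most 1, and the point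
     evaluation constant K does not depend on the power. *)
  have "((norm (\<psi> z))\<^sup>2) ^ m \<le> K" for m
  proof -
    define f where "f = (\<lambda>z. \<psi> z ^ m)"
    have f: "inner_function f" unfolding f_def by (rule inner_function_power[OF \<psi>])
    then have fh: "f holomorphic_on \<U>" by (simp add: inner_function_def bounded_analytic_def)
    have "(\<lambda>n. square_mean f (real n / real (Suc n))) \<longlonglongrightarrow> square_mean (\<lambda>_. 1) 0"
      using inner_square_mean_tendsto[OF f, of "\<lambda>_. 1" 0, OF _ _ _ tendsto_one_radii] by simp
    moreover have "square_mean (\<lambda>_. 1) 0 = 1" by (simp add: square_mean_def)
    ultimately have lim: "(\<lambda>n. square_mean f (real n / real (Suc n))) \<longlonglongrightarrow> 1" by simp
    have "\<forall>\<^sub>F n in sequentially. r < real n / real (Suc n)"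
      using order_tendstoD(1)[OF tendsto_one_radii(3) r(2)] .
    then have "\<forall>\<^sub>F n in sequentially. square_mean f r \<le> square_mean f (real n / real (Suc n))"
      by eventually_elim
         (use r norm_ge_zero[of z] tendsto_one_radii(2) in \<open>auto intro!: square_mean_mono fh simp del: norm_ge_zero\<close>)
    then have "square_mean f r \<le> 1"
      by (rule tendsto_lowerbound[OF lim]) simp
    then have "(norm (f z))\<^sup>2 \<le> K"
      using pt[OF fh] K by (meson mult_left_le order_trans)
    then show ?thesis by (simp add: f_def norm_power power_mult[symmetric] mult.commute)
  qed
  moreover obtain m where "K < ((norm (\<psi> z))\<^sup>2) ^ m"
    using real_arch_pow[OF big] by blast
  ultimately show False by (meson not_less)
qed

lemma nonconstant_inner_function_norm_less_1:
  assumes \<psi>: "inner_function \<psi>" and nc: "\<not> \<psi> constant_on \<U>" and z: "z \<in> \<U>"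
  shows "norm (\<psi> z) < 1"
proof (rule ccontr)
  assume "\<not> norm (\<psi> z) < 1"
  then have "norm (\<psi> w) \<le> norm (\<psi> z)" if "w \<in> \<U>" for w
    using inner_function_norm_le_1[OF \<psi> that] by linarith
  then have "\<psi> constant_on \<U>"
    using \<psi> z by (intro maximum_modulus_principle[of \<psi> \<U> \<U> z])
      (auto simp: inner_function_def bounded_analytic_def)
  with nc show False ..
qed

text \<open>The half of the isometry property that excludes a loss of norm. For dilated functions it follows
  from the radial limits; they are dense, and no boundary values of \<open>g\<close> itself are needed.\<close>

lemma hardy2_norm_inner_mult:
  assumes \<psi>: "inner_function \<psi>" and g: "g \<in> hardy2"
  shows "hardy2_norm g \<le> hardy2_norm (toeplitz \<psi> g)"
proof -
  have \<psi>b: "bounded_analytic \<psi>" using \<psi> by (simp add: inner_function_def)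
  define T where "T = toeplitz \<psi>"
  have T: "T f \<in> hardy2" if "f \<in> hardy2" for f
    unfolding T_def by (rule toeplitz_hardy2[OF \<psi>b that])
  obtain C where C0: "0 \<le> C" and C: "\<And>f. f \<in> hardy2 \<Longrightarrow> hardy2_norm (T f) \<le> C * hardy2_norm f"
    unfolding T_def using bounded_operator_norm_bound[OF bounded_operator_toeplitz[OF \<psi>b]] by blast
  define \<rho> where "\<rho> = (\<lambda>n. real n / real (Suc n))"
  have \<rho>: "\<And>n. 0 \<le> \<rho> n" "\<And>n. \<rho> n < 1" "\<rho> \<longlonglongrightarrow> 1"
    unfolding \<rho>_def by (rule tendsto_one_radii)+
  define d where "d n = hardy2_norm (\<lambda>z. dilation (\<rho> n) g z - g z)" for n
  have d: "d \<longlonglongrightarrow> 0" unfolding d_def by (rule dilation_tendsto[OF g \<rho>])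
  (* For a dilated function the radial limits can be taken under the integral; the error of the
     dilation is weighted by 1 + 1 / e, which is harmless because d tends to 0 for fixed e. *)
  have dilated: "square_mean g (\<rho> n) \<le> (1 + e) * (hardy2_norm (T g))\<^sup>2 + (1 + 1 / e) * (C * d n)\<^sup>2"
    if e: "0 < e" for e n
  proof (rule LIMSEQ_le_const2)
    show "(\<lambda>m. square_mean (\<lambda>z. \<psi> z * g (of_real (\<rho> n) * z)) (\<rho> m)) \<longlonglongrightarrow> square_mean g (\<rho> n)"
      by (rule inner_square_mean_tendsto[OF \<psi> hardy2_holomorphic[OF g] \<rho>(1,2) \<rho>])
    have diff: "(\<lambda>z. dilation (\<rho> n) g z - g z) \<in> hardy2"
      by (intro hardy2_diff dilation_hardy2 g \<rho>)
    show "\<exists>N. \<forall>m\<ge>N. square_mean (\<lambda>z. \<psi> z * g (of_real (\<rho> n) * z)) (\<rho> m)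
        \<le> (1 + e) * (hardy2_norm (T g))\<^sup>2 + (1 + 1 / e) * (C * d n)\<^sup>2"
    proof (intro exI allI impI)
      fix m
      have "square_mean (\<lambda>z. \<psi> z * g (of_real (\<rho> n) * z)) (\<rho> m)
          = square_mean (\<lambda>z. T g z + T (\<lambda>z. dilation (\<rho> n) g z - g z) z) (\<rho> m)"
        by (rule square_mean_cong[OF _ \<rho>(1,2)]) (simp add: T_def toeplitz_def dilation_def algebra_simps)
      also have "\<dots> \<le> (1 + e) * square_mean (T g) (\<rho> m)
          + (1 + 1 / e) * square_mean (T (\<lambda>z. dilation (\<rho> n) g z - g z)) (\<rho> m)"
        by (intro square_mean_add_le hardy2_holomorphic T g diff \<rho> e)
      also have "\<dots> \<le> (1 + e) * (hardy2_norm (T g))\<^sup>2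
          + (1 + 1 / e) * (hardy2_norm (T (\<lambda>z. dilation (\<rho> n) g z - g z)))\<^sup>2"
        using e by (intro add_mono mult_left_mono square_mean_le_hardy2_norm T g diff \<rho>) auto
      also have "\<dots> \<le> (1 + e) * (hardy2_norm (T g))\<^sup>2 + (1 + 1 / e) * (C * d n)\<^sup>2"
        using e C[OF diff] hardy2_norm_nonneg[OF T[OF diff]]
        by (intro add_left_mono mult_left_mono power_mono) (auto simp: d_def)
      finally show "square_mean (\<lambda>z. \<psi> z * g (of_real (\<rho> n) * z)) (\<rho> m)
          \<le> (1 + e) * (hardy2_norm (T g))\<^sup>2 + (1 + 1 / e) * (C * d n)\<^sup>2" .
    qed
  qed
  have "(hardy2_norm g)\<^sup>2 \<le> (1 + e) * (hardy2_norm (T g))\<^sup>2" if e: "0 < e" for e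
  proof (rule hardy2_norm_square_le[OF g])
    fix r :: real assume r: "0 \<le> r" "r < 1"
    have "(\<lambda>n. (1 + e) * (hardy2_norm (T g))\<^sup>2 + (1 + 1 / e) * (C * d n)\<^sup>2)
        \<longlonglongrightarrow> (1 + e) * (hardy2_norm (T g))\<^sup>2 + (1 + 1 / e) * (C * 0)\<^sup>2"
      by (intro tendsto_intros d)
    moreover have "\<forall>\<^sub>F n in sequentially.
        square_mean g r \<le> (1 + e) * (hardy2_norm (T g))\<^sup>2 + (1 + 1 / e) * (C * d n)\<^sup>2"
      using order_tendstoD(1)[OF \<rho>(3) r(2)]
    proof eventually_elim
      case (elim n)
      show ?case
        using square_mean_mono[OF hardy2_holomorphic[OF g] r(1) less_imp_le[OF elim] \<rho>(2)] dilated[OF e, of n]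
        by (rule order_trans)
    qed
    ultimately show "square_mean g r \<le> (1 + e) * (hardy2_norm (T g))\<^sup>2"
      using tendsto_lowerbound by fastforce
  qed
  note step = this
  have "(\<lambda>e. (1 + e) * (hardy2_norm (T g))\<^sup>2) \<midarrow>0\<rightarrow> (1 + 0) * (hardy2_norm (T g))\<^sup>2"
    by (intro tendsto_intros)
  then have "((\<lambda>e. (1 + e) * (hardy2_norm (T g))\<^sup>2) \<longlongrightarrow> (hardy2_norm (T g))\<^sup>2) (at_right 0)"
    by (simp add: filterlim_at_split)
  then have "(hardy2_norm g)\<^sup>2 \<le> (hardy2_norm (T g))\<^sup>2"
    by (rule tendsto_lowerbound) (auto simp: eventually_at_right_less step intro: eventually_mono[OF eventually_at_right_less])
  then show ?thesis
    using hardy2_norm_nonneg[OF T[OF g]] unfolding T_def by (rule power2_le_imp_le)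
qed

section \<open>The Herglotz transform\<close>

text \<open>The range of integration is absorbed into the density, which is thought of as vanishing outside
  \<open>{0..2*pi}\<close>; the normalising factor \<open>1 / (2 * pi)\<close> is left out.\<close>

definition herglotz :: "(real \<Rightarrow> real) \<Rightarrow> complex \<Rightarrow> complex" where
  "herglotz v z = (LINT t|lborel. (cis t + z) / (cis t - z) * of_real (v t))"

lemma cis_minus_lower_bound: "norm z \<le> s \<Longrightarrow> 1 - s \<le> norm (cis t - z)"
  using norm_triangle_ineq2[of "cis t" z] by simp

lemma cis_neq_disc: "z \<in> \<U> \<Longrightarrow> cis t \<noteq> z"
  by (metis dist_0_norm less_irrefl mem_ball norm_cis)

lemma integrable_bounded_mult:
  fixes v :: "real \<Rightarrow> real" and b :: "real \<Rightarrow> complex"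
  assumes v: "integrable lborel v" and b: "continuous_on UNIV b" and B: "\<And>t. norm (b t) \<le> B"
  shows "integrable lborel (\<lambda>t. b t * of_real (v t))"
proof (rule Bochner_Integration.integrable_bound)
  show "integrable lborel (\<lambda>t. B * \<bar>v t\<bar>)"
    using v by simp
  have [measurable]: "b \<in> borel_measurable borel" "v \<in> borel_measurable borel"
    using b v by (auto intro: borel_measurable_continuous_onI)
  show "(\<lambda>t. b t * of_real (v t)) \<in> borel_measurable lborel"
    by measurable
  show "AE t in lborel. norm (b t * of_real (v t)) \<le> norm (B * \<bar>v t\<bar>)"
    using B order_trans[OF norm_ge_zero B] by (auto simp: norm_mult intro!: mult_right_mono)
qed

lemma continuous_herglotz_kernel:
  "z \<in> \<U> \<Longrightarrow> continuous_on UNIV (\<lambda>t. (cis t + z) / (cis t - z))"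
  by (intro continuous_intros) (auto dest: cis_neq_disc)

lemma integrable_herglotz:
  assumes v: "integrable lborel v" and z: "z \<in> \<U>"
  shows "integrable lborel (\<lambda>t. (cis t + z) / (cis t - z) * of_real (v t))"
proof (rule integrable_bounded_mult[OF v continuous_herglotz_kernel[OF z]])
  fix t
  show "norm ((cis t + z) / (cis t - z)) \<le> (1 + norm z) / (1 - norm z)"
    unfolding norm_divide using z cis_minus_lower_bound[of z "norm z" t] norm_triangle_ineq[of "cis t" z]
    by (intro frac_le) auto
qed

lemma herglotz_diff:
  assumes "integrable lborel v" "integrable lborel w" "z \<in> \<U>"
  shows "herglotz (\<lambda>t. v t - w t) z = herglotz v z - herglotz w z"
  unfolding herglotz_def of_real_diff right_diff_distrib
  by (rule Bochner_Integration.integral_diff; rule integrable_herglotz; fact)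

lemma herglotz_scale:
  "herglotz (\<lambda>t. a * v t) z = of_real a * herglotz v z"
  by (cases "a = 0") (simp_all add: herglotz_def mult.left_commute flip: integral_mult_right_zero)

text \<open>The real part is the Poisson kernel, with numerator \<open>1 - (norm z)\<^sup>2\<close>.\<close>

lemma Re_herglotz_kernel_nonneg:
  assumes z: "z \<in> \<U>"
  shows "0 \<le> Re ((cis t + z) / (cis t - z))"
proof -
  have "(cis t + z) / (cis t - z) = (cis t + z) * cnj (cis t - z) / of_real ((norm (cis t - z))\<^sup>2)"
    using cis_neq_disc[OF z, of t] unfolding complex_norm_square
    by (subst mult_divide_mult_cancel_right) auto
  moreover have "Re ((cis t + z) * cnj (cis t - z)) = 1 - (norm z)\<^sup>2"
    unfolding cmod_power2 using sin_cos_squared_add[of t]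
    by (simp add: power2_eq_square algebra_simps)
  moreover have "(norm z)\<^sup>2 \<le> 1" using z by (simp add: power_le_one)
  ultimately show ?thesis by (simp del: of_real_power)
qed

lemma Re_herglotz_mono:
  assumes v: "integrable lborel v" and w: "integrable lborel w" and le: "\<And>t. v t \<le> w t" and z: "z \<in> \<U>"
  shows "Re (herglotz v z) \<le> Re (herglotz w z)"
proof -
  have "Re (herglotz v z) = (LINT t|lborel. Re ((cis t + z) / (cis t - z) * of_real (v t)))"
    if "integrable lborel v" for v
    unfolding herglotz_def by (rule integral_Re[symmetric, OF integrable_herglotz[OF that z]])
  moreover have "(LINT t|lborel. Re ((cis t + z) / (cis t - z) * of_real (v t)))
      \<le> (LINT t|lborel. Re ((cis t + z) / (cis t - z) * of_real (w t)))"
  proof (intro integral_mono integrable_Re integrable_herglotz v w z)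
    fix t
    have "Re (a * of_real x) = Re a * x" for a x by simp
    then show "Re ((cis t + z) / (cis t - z) * of_real (v t)) \<le> Re ((cis t + z) / (cis t - z) * of_real (w t))"
      by (simp only: mult_left_mono[OF le Re_herglotz_kernel_nonneg[OF z]])
  qed
  ultimately show ?thesis using v w by simp
qed

text \<open>Differentiation under the integral, for a density that is merely integrable.\<close>

lemma herglotz_has_field_derivative:
  assumes v: "integrable lborel v" and z: "z \<in> \<U>"
  shows "(herglotz v has_field_derivative (LINT t|lborel. 2 * cis t / (cis t - z)\<^sup>2 * of_real (v t))) (at z)"
proof -
  define s where "s = (1 + norm z) / 2"
  have s: "norm z < s" "s < 1" using z by (auto simp: s_def)
  have sub: "w \<in> \<U>" if "w \<in> ball 0 s" for w :: complex using that s by auto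
  let ?D = "LINT t|lborel. 2 * cis t / (cis t - z)\<^sup>2 * of_real (v t)"
  let ?q = "\<lambda>w t. 2 * cis t / ((cis t - w) * (cis t - z))"
  have v_meas [measurable]: "v \<in> borel_measurable borel" using v by auto
  have q_cont: "continuous_on UNIV (?q w)" if "w \<in> \<U>" for w
    using that z by (intro continuous_intros) (auto dest: cis_neq_disc)
  have meas: "(\<lambda>t. ?q w t * of_real (v t)) \<in> borel_measurable lborel" if "w \<in> \<U>" for w
  proof (rule borel_measurable_times)
    show "?q w \<in> borel_measurable lborel"
      using borel_measurable_continuous_onI[OF q_cont[OF that]] by simp
  qed simp
  have q_bound: "norm (?q w t) \<le> 2 / (1 - s)\<^sup>2" if "w \<in> ball 0 s" for w t
  proof -
    have "(1 - s) * (1 - s) \<le> norm (cis t - w) * norm (cis t - z)"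
      using that s by (intro mult_mono cis_minus_lower_bound) auto
    then show ?thesis
      unfolding norm_divide norm_mult power2_eq_square using s by (intro frac_le) auto
  qed
  (* The difference quotient of the kernel is explicit, and bounded uniformly for w in the ball of radius s. *)
  have quotient: "(herglotz v w - herglotz v z) / (w - z) = (LINT t|lborel. ?q w t * of_real (v t))"
    if "w \<in> ball 0 s - {z}" for w
  proof -
    have w: "w \<in> \<U>" "w \<noteq> z" using that sub by auto
    have "herglotz v w - herglotz v z = (LINT t|lborel. (cis t + w) / (cis t - w) * of_real (v t)
        - (cis t + z) / (cis t - z) * of_real (v t))"
      unfolding herglotz_def
      by (rule Bochner_Integration.integral_diff[symmetric]; rule integrable_herglotz; fact)
    also have "\<dots> = (LINT t|lborel. (w - z) * (?q w t * of_real (v t)))"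
    proof (rule Bochner_Integration.integral_cong[OF refl])
      fix t
      have "cis t - w \<noteq> 0" "cis t - z \<noteq> 0" using cis_neq_disc w z by auto
      then have "(cis t + w) / (cis t - w) - (cis t + z) / (cis t - z) = (w - z) * ?q w t"
        by (simp add: divide_simps) (simp add: algebra_simps)
      then show "(cis t + w) / (cis t - w) * of_real (v t) - (cis t + z) / (cis t - z) * of_real (v t)
          = (w - z) * (?q w t * of_real (v t))"
        by (metis left_diff_distrib mult.assoc)
    qed
    also have "\<dots> = (w - z) * (LINT t|lborel. ?q w t * of_real (v t))"
      by (rule integral_mult_right_zero)
    finally show ?thesis using w by simp
  qed
  have "((\<lambda>w. (herglotz v w - herglotz v z) / (w - z)) \<longlongrightarrow> ?D) (at z within ball 0 s)"
    unfolding tendsto_at_iff_sequentially comp_def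
  proof (intro allI impI)
    fix X assume X: "\<forall>i. X i \<in> ball 0 s - {z}" and lim: "X \<longlonglongrightarrow> z"
    have "(\<lambda>i. LINT t|lborel. ?q (X i) t * of_real (v t)) \<longlonglongrightarrow> ?D"
    proof (rule integral_dominated_convergence)
      show "integrable lborel (\<lambda>t. 2 / (1 - s)\<^sup>2 * \<bar>v t\<bar>)" using v by simp
      show "AE t in lborel. (\<lambda>i. ?q (X i) t * of_real (v t)) \<longlonglongrightarrow> 2 * cis t / (cis t - z)\<^sup>2 * of_real (v t)"
        unfolding power2_eq_square using cis_neq_disc[OF z] by (auto intro!: tendsto_intros lim)
      show "AE t in lborel. norm (?q (X i) t * of_real (v t)) \<le> 2 / (1 - s)\<^sup>2 * \<bar>v t\<bar>" for i
        unfolding norm_mult[of _ "of_real _"] using q_bound[of "X i"] X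
        by (intro AE_I2 mult_mono) auto
      show "(\<lambda>t. ?q (X i) t * of_real (v t)) \<in> borel_measurable lborel" for i
        using X by (intro meas sub) auto
      show "(\<lambda>t. 2 * cis t / (cis t - z)\<^sup>2 * of_real (v t)) \<in> borel_measurable lborel"
        using meas[OF z] by (simp only: power2_eq_square)
    qed
    then show "(\<lambda>i. (herglotz v (X i) - herglotz v z) / (X i - z)) \<longlonglongrightarrow> ?D"
      using X by (simp add: quotient)
  qed
  then have "(herglotz v has_field_derivative ?D) (at z within ball 0 s)"
    by (simp add: has_field_derivative_iff)
  then show ?thesis using s by (simp add: at_within_open[of z "ball 0 s"])
qed

lemma herglotz_holomorphic: "integrable lborel v \<Longrightarrow> herglotz v holomorphic_on \<U>"
  using herglotz_has_field_derivative holomorphic_on_open[OF open_ball] by blast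

lemma integrable_indicator_circle: "integrable lborel (indicator {0..2*pi} :: real \<Rightarrow> real)"
  by simp

text \<open>The normalisation of the Poisson kernel.\<close>

lemma herglotz_indicator:
  assumes z: "z \<in> \<U>"
  shows "herglotz (indicator {0..2*pi}) z = 2 * pi"
proof -
  (* Differentiating under the integral gives the integral of the derivative of a function that is
     periodic in t, so the transform is constant, and its value can be read off at 0. *)
  have zero: "(LINT t|lborel. 2 * cis t / (cis t - z)\<^sup>2 * of_real (indicator {0..2*pi} t)) = 0"
    if z: "z \<in> \<U>" for z
  proof -
    have "(LINT t|lborel. indicator {0..2*pi} t *\<^sub>R (2 * cis t / (cis t - z)\<^sup>2))
        = 2 * \<i> / (cis (2*pi) - z) - 2 * \<i> / (cis 0 - z)"
    proof (rule integral_FTC_Icc)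
      fix t :: real
      have ne: "exp (\<i> * of_real t) - z \<noteq> 0" using cis_neq_disc[OF z, of t] by (simp add: cis_conv_exp)
      have "((\<lambda>w. 2 * \<i> / (exp (\<i> * w) - z)) has_field_derivative
          2 * exp (\<i> * of_real t) / (exp (\<i> * of_real t) - z)\<^sup>2) (at (of_real t))"
        using ne by (auto intro!: derivative_eq_intros simp: power2_eq_square field_simps)
      then have "((\<lambda>t. 2 * \<i> / (exp (\<i> * of_real t) - z)) has_vector_derivative
          2 * exp (\<i> * of_real t) / (exp (\<i> * of_real t) - z)\<^sup>2) (at t within {0..2*pi})"
        by (rule has_vector_derivative_real_field)
      then show "((\<lambda>t. 2 * \<i> / (cis t - z)) has_vector_derivative 2 * cis t / (cis t - z)\<^sup>2)
          (at t within {0..2*pi})"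
        by (simp add: cis_conv_exp)
    next
      show "continuous_on {0..2*pi} (\<lambda>t. 2 * cis t / (cis t - z)\<^sup>2)"
        by (intro continuous_intros) (use cis_neq_disc[OF z] in auto)
    qed simp
    then show ?thesis by (simp add: scaleR_conv_of_real cis_2pi mult.commute[of "of_real (indicator _ _)"])
  qed
  have "\<exists>c. \<forall>z\<in>\<U>. herglotz (indicator {0..2*pi}) z = c"
  proof (rule has_field_derivative_zero_constant)
    fix w :: complex assume w: "w \<in> \<U>"
    show "(herglotz (indicator {0..2*pi}) has_field_derivative 0) (at w within \<U>)"
      using herglotz_has_field_derivative[OF integrable_indicator_circle w] zero[OF w]
      by (auto intro: has_field_derivative_at_within)
  qed simp
  then have "herglotz (indicator {0..2*pi}) z = herglotz (indicator {0..2*pi}) 0"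
    using z by (metis centre_in_ball zero_less_one)
  also have "\<dots> = (LINT t|lborel. of_real (indicator {0..2*pi} t))"
    by (simp add: herglotz_def)
  also have "\<dots> = 2 * pi" by (simp only: integral_complex_of_real) simp
  finally show ?thesis .
qed

section \<open>Outer functions\<close>

text \<open>The power of the defining exponential belongs to the boundary modulus \<open>k t ^ n\<close>.\<close>

lemma outer_function_power:
  assumes "outer_function \<phi>"
  shows "outer_function (\<lambda>z. \<phi> z ^ n)"
proof -
  obtain c k where "norm c = 1" and k: "k \<in> borel_measurable lborel" "\<forall>t. 0 < k t"
     "set_integrable lborel {0..2*pi} (\<lambda>t. ln (k t))" and
     \<phi>: "\<forall>z\<in>\<U>. \<phi> z = c * exp (1 / (2 * pi) *
        (LINT t:{0..2*pi}|lborel. (cis t + z) / (cis t - z) * of_real (ln (k t))))"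
    using assms unfolding outer_function_def by blast
  have ln: "ln (k t ^ n) = real n * ln (k t)" for t using k(2) by (simp add: ln_realpow)
  show ?thesis
    unfolding outer_function_def
  proof (intro exI conjI ballI)
    show "norm (c ^ n) = 1" using \<open>norm c = 1\<close> by (simp add: norm_power)
    show "(\<lambda>t. k t ^ n) \<in> borel_measurable lborel" using k(1) by measurable
    show "\<forall>t. 0 < k t ^ n" using k(2) by simp
    show "set_integrable lborel {0..2*pi} (\<lambda>t. ln (k t ^ n))"
      unfolding ln using k(3) by simp
    fix z assume "z \<in> \<U>"
    then have "\<phi> z ^ n = c ^ n * exp (of_nat n * (1 / (2 * pi) *
        (LINT t:{0..2*pi}|lborel. (cis t + z) / (cis t - z) * of_real (ln (k t)))))"
      using \<phi> by (simp only: power_mult_distrib exp_of_nat_mult)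
    also have "of_nat n * (1 / (2 * pi) *
        (LINT t:{0..2*pi}|lborel. (cis t + z) / (cis t - z) * of_real (ln (k t))))
      = 1 / (2 * pi) * (LINT t:{0..2*pi}|lborel. (cis t + z) / (cis t - z) * of_real (ln (k t ^ n)))"
      unfolding ln of_real_mult of_real_of_nat_eq mult.left_commute[of _ "of_nat n"]
        set_integral_mult_right ..
    finally show "\<phi> z ^ n = c ^ n * exp (1 / (2 * pi) *
        (LINT t:{0..2*pi}|lborel. (cis t + z) / (cis t - z) * of_real (ln (k t ^ n))))" .
  qed
qed

text \<open>If \<open>\<phi>\<close> has density \<open>v = ln k\<close>, the inverse of the outer function with density \<open>max v (- n)\<close> is
  bounded by \<open>exp n\<close>. Its product with \<open>\<phi>\<close> has density \<open>min (v + n) 0\<close>: it is bounded by \<open>1\<close>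
  since this density is nonpositive, and tends to \<open>1\<close> since the density tends to \<open>0\<close> dominated by
  \<open>\<bar>v\<bar>\<close>.\<close>

lemma outer_function_approximate_inverse:
  assumes "outer_function \<phi>"
  obtains h where "\<And>n. bounded_analytic (h n)"
    and "\<And>n z. z \<in> \<U> \<Longrightarrow> norm (\<phi> z * h n z) \<le> 1"
    and "\<And>z. z \<in> \<U> \<Longrightarrow> (\<lambda>n. \<phi> z * h n z) \<longlonglongrightarrow> 1"
proof -
  obtain c k where c: "norm c = 1" and k: "k \<in> borel_measurable lborel" "\<forall>t. 0 < k t"
     "set_integrable lborel {0..2*pi} (\<lambda>t. ln (k t))" and
     \<phi>: "\<forall>z\<in>\<U>. \<phi> z = c * exp (1 / (2 * pi) *
        (LINT t:{0..2*pi}|lborel. (cis t + z) / (cis t - z) * of_real (ln (k t))))"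
    using assms unfolding outer_function_def by blast
  define v where "v t = indicator {0..2*pi} t * ln (k t)" for t
  have v: "integrable lborel v"
    using k(3) by (simp add: set_integrable_def v_def[abs_def])
  have \<phi>v: "\<phi> z = c * exp (herglotz v z / (2 * pi))" if "z \<in> \<U>" for z
    using \<phi> that by (simp add: herglotz_def set_lebesgue_integral_def v_def scaleR_conv_of_real mult_ac)
  (* Truncating from below keeps h n, the exponential of the negated transform, bounded. *)
  define w where "w n t = max (v t) (- real n)" for n t
  have w: "integrable lborel (w n)" for n
    by (rule Bochner_Integration.integrable_bound[OF v]) (use v in \<open>auto simp: w_def[abs_def]\<close>)
  define h where "h n z = exp (- herglotz (w n) z / (2 * pi)) / c" for n z
  have prod: "\<phi> z * h n z = exp (herglotz (\<lambda>t. v t - w n t) z / (2 * pi))" if "z \<in> \<U>" for n z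
  proof -
    have "c \<noteq> 0" using c by auto
    then have "\<phi> z * h n z = exp (herglotz v z / (2 * pi)) * exp (- herglotz (w n) z / (2 * pi))"
      unfolding \<phi>v[OF that] h_def by simp
    also have "\<dots> = exp (herglotz v z / (2 * pi) + - herglotz (w n) z / (2 * pi))"
      by (rule exp_add[symmetric])
    also have "herglotz v z / (2 * pi) + - herglotz (w n) z / (2 * pi)
        = herglotz (\<lambda>t. v t - w n t) z / (2 * pi)"
      unfolding herglotz_diff[OF v w[of n] that] by (simp add: diff_divide_distrib)
    finally show ?thesis .
  qed
  show ?thesis
  proof
    fix n
    have "h n holomorphic_on \<U>"
      unfolding h_def using c by (auto intro!: holomorphic_intros herglotz_holomorphic w)
    moreover have "norm (h n z) \<le> exp n" if z: "z \<in> \<U>" for z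
    proof -
      (* w n is at least - n, and the Poisson integral of the constant - n is - n. *)
      have "Re (herglotz (\<lambda>t. - real n * indicator {0..2*pi} t) z) \<le> Re (herglotz (w n) z)"
        by (rule Re_herglotz_mono[OF integrable_mult_right[OF integrable_indicator_circle] w _ z])
           (auto simp: w_def v_def indicator_def)
      then have "- real n * (2 * pi) \<le> Re (herglotz (w n) z)"
        by (simp only: herglotz_scale herglotz_indicator[OF z] Re_complex_of_real flip: of_real_mult)
      then have "- Re (herglotz (w n) z) / (2 * pi) \<le> real n"
        by (simp add: field_simps)
      moreover have "norm (h n z) = exp (- Re (herglotz (w n) z) / (2 * pi))"
        by (simp add: h_def norm_divide c Re_divide_of_real flip: of_real_mult)
      ultimately show ?thesis by simp
    qed
    ultimately show "bounded_analytic (h n)"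
      unfolding bounded_analytic_def bounded_iff by blast
  next
    fix n and z :: complex assume z: "z \<in> \<U>"
    have "Re (herglotz (\<lambda>t. v t - w n t) z) \<le> Re (herglotz (\<lambda>_. 0) z)"
      by (rule Re_herglotz_mono[OF Bochner_Integration.integrable_diff[OF v w] _ _ z]) (auto simp: w_def)
    then have "Re (herglotz (\<lambda>t. v t - w n t) z) / (2 * pi) \<le> 0"
      by (simp add: herglotz_def divide_nonpos_pos)
    then show "norm (\<phi> z * h n z) \<le> 1"
      unfolding prod[OF z] norm_exp_eq_Re by (simp add: Re_divide_of_real flip: of_real_mult)
  next
    fix z :: complex assume z: "z \<in> \<U>"
    have "(\<lambda>n. herglotz (\<lambda>t. v t - w n t) z) \<longlonglongrightarrow> (LINT t::real|lborel. 0)"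
      unfolding herglotz_def
    proof (rule integral_dominated_convergence)
      show "integrable lborel (\<lambda>t. norm ((cis t + z) / (cis t - z) * of_real (v t)))"
        by (intro integrable_norm integrable_herglotz v z)
      show "(\<lambda>t. (cis t + z) / (cis t - z) * of_real (v t - w n t)) \<in> borel_measurable lborel" for n
        by (intro borel_measurable_integrable integrable_herglotz Bochner_Integration.integrable_diff v w z)
      show "AE t in lborel. (\<lambda>n. (cis t + z) / (cis t - z) * of_real (v t - w n t)) \<longlonglongrightarrow> 0"
      proof (intro AE_I2)
        fix t
        have "\<forall>\<^sub>F n in sequentially. - v t \<le> real n"
          by real_asymp
        then have "\<forall>\<^sub>F n in sequentially. (cis t + z) / (cis t - z) * of_real (v t - w n t) = 0"
          by eventually_elim (simp add: w_def max_def)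
        then show "(\<lambda>n. (cis t + z) / (cis t - z) * of_real (v t - w n t)) \<longlonglongrightarrow> 0"
          by (rule tendsto_eventually)
      qed
      show "AE t in lborel. norm ((cis t + z) / (cis t - z) * of_real (v t - w n t))
          \<le> norm ((cis t + z) / (cis t - z) * of_real (v t))" for n
        unfolding norm_mult norm_of_real
        by (intro AE_I2 mult_left_mono) (auto simp: w_def max_def)
    qed simp
    then have "(\<lambda>n. exp (herglotz (\<lambda>t. v t - w n t) z / (2 * pi))) \<longlonglongrightarrow> exp ((LINT t::real|lborel. 0) / complex_of_real (2 * pi))"
      by (intro tendsto_intros) auto
    then show "(\<lambda>n. \<phi> z * h n z) \<longlonglongrightarrow> 1"
      by (simp add: prod[OF z])
  qed
qed

text \<open>Multiplying \<open>f\<close> by the approximate inverses of \<open>\<phi>\<close> produces the preimages.\<close>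

lemma outer_toeplitz_dense_range:
  assumes \<phi>: "bounded_analytic \<phi>" and out: "outer_function \<phi>" and f: "f \<in> hardy2"
  obtains g where "\<And>n. g n \<in> hardy2"
    and "\<And>n. hardy2_norm (toeplitz \<phi> (g n)) \<le> hardy2_norm f"
    and "(\<lambda>n. hardy2_norm (\<lambda>z. toeplitz \<phi> (g n) z - f z)) \<longlonglongrightarrow> 0"
proof -
  obtain h where h: "\<And>n. bounded_analytic (h n)"
    and le: "\<And>n z. z \<in> \<U> \<Longrightarrow> norm (\<phi> z * h n z) \<le> 1"
    and lim: "\<And>z. z \<in> \<U> \<Longrightarrow> (\<lambda>n. \<phi> z * h n z) \<longlonglongrightarrow> 1"
    using outer_function_approximate_inverse[OF out] by blast
  define g where "g n = toeplitz (h n) f" for n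
  have g: "g n \<in> hardy2" for n
    unfolding g_def by (rule toeplitz_hardy2[OF h f])
  have \<phi>g: "toeplitz \<phi> (g n) \<in> hardy2" for n
    by (rule toeplitz_hardy2[OF \<phi> g])
  have eq: "toeplitz \<phi> (g n) = toeplitz (\<lambda>z. \<phi> z * h n z) f" for n
    by (simp add: g_def toeplitz_def mult.assoc)
  (* The bound by norm f, with no constant in front, is what makes pointwise convergence suffice below. *)
  have norm_le: "hardy2_norm (toeplitz \<phi> (g n)) \<le> hardy2_norm f" for n
  proof (rule power2_le_imp_le[OF hardy2_norm_square_le[OF \<phi>g] hardy2_norm_nonneg[OF f]])
    fix r :: real assume r: "0 \<le> r" "r < 1"
    have "square_mean (toeplitz \<phi> (g n)) r \<le> 1\<^sup>2 * square_mean f r"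
      unfolding eq
      by (rule square_mean_mult_le) (use \<phi> h f le r in \<open>auto simp: bounded_analytic_def hardy2_def intro!: holomorphic_intros\<close>)
    then show "square_mean (toeplitz \<phi> (g n)) r \<le> (hardy2_norm f)\<^sup>2"
      using square_mean_le_hardy2_norm[OF f r] by simp
  qed
  have "(\<lambda>n. hardy2_norm (\<lambda>z. toeplitz \<phi> (g n) z - f z)) \<longlonglongrightarrow> 0"
  proof (rule hardy2_norm_tendsto_0[OF \<phi>g f norm_le])
    fix z assume "z \<in> \<U>"
    then have "(\<lambda>n. \<phi> z * h n z * f z) \<longlonglongrightarrow> 1 * f z"
      by (intro tendsto_intros lim)
    then show "(\<lambda>n. toeplitz \<phi> (g n) z) \<longlonglongrightarrow> f z"
      unfolding eq by (simp add: toeplitz_def)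
  qed
  with g norm_le show ?thesis by (rule that)
qed

section \<open>Intertwining operators\<close>

lemma intertwining_power:
  assumes X: "\<And>f. f \<in> hardy2 \<Longrightarrow> X (toeplitz \<phi> f) = toeplitz \<psi> (X f)"
    and \<phi>: "bounded_analytic \<phi>" and f: "f \<in> hardy2"
  shows "X (toeplitz (\<lambda>z. \<phi> z ^ n) f) = toeplitz (\<lambda>z. \<psi> z ^ n) (X f)"
  using f
proof (induction n arbitrary: f)
  case 0
  then show ?case by (simp add: toeplitz_def)
next
  case (Suc n)
  have "toeplitz (\<lambda>z. \<phi> z ^ Suc n) f = toeplitz (\<lambda>z. \<phi> z ^ n) (toeplitz \<phi> f)" for \<phi> f
    by (simp add: toeplitz_def mult_ac)
  then show ?case
    using Suc.IH[OF toeplitz_hardy2[OF \<phi> Suc.prems]] X[OF Suc.prems] by simp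
qed

text \<open>By density of the range of \<open>toeplitz \<phi>\<close>, \<open>X f\<close> is the limit of
  \<open>X (toeplitz \<phi> (g n)) = toeplitz \<psi> (X (g n))\<close> for suitable \<open>g n\<close>. The bound depends on the two symbols
  only through the value \<open>\<psi> z\<close>, so that it can be applied to all their powers.\<close>

lemma intertwining_point_bound:
  assumes X: "bounded_operator X"
    and XT: "\<And>f. f \<in> hardy2 \<Longrightarrow> X (toeplitz \<phi> f) = toeplitz \<psi> (X f)"
    and \<phi>: "bounded_analytic \<phi>" "outer_function \<phi>" and \<psi>: "inner_function \<psi>"
    and f: "f \<in> hardy2" and C: "\<And>f. f \<in> hardy2 \<Longrightarrow> hardy2_norm (X f) \<le> C * hardy2_norm f" "0 \<le> C"
    and K: "\<And>f. f \<in> hardy2 \<Longrightarrow> norm (f z) \<le> K * hardy2_norm f" "0 \<le> K"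
  shows "norm (X f z) \<le> norm (\<psi> z) * (K * C * hardy2_norm f)"
proof -
  have XH: "X f \<in> hardy2" if "f \<in> hardy2" for f
    using X that by (simp add: bounded_operator_def)
  obtain g where g: "\<And>n. g n \<in> hardy2"
    and le: "\<And>n. hardy2_norm (toeplitz \<phi> (g n)) \<le> hardy2_norm f"
    and lim: "(\<lambda>n. hardy2_norm (\<lambda>z. toeplitz \<phi> (g n) z - f z)) \<longlonglongrightarrow> 0"
    using outer_toeplitz_dense_range[OF \<phi> f] by blast
  have Tg: "toeplitz \<phi> (g n) \<in> hardy2" for n by (rule toeplitz_hardy2[OF \<phi>(1) g])
  (* The value at z of psi times X (g n) carries the factor psi z; the factor
     X (g n) is controlled by its product with psi, which is X (phi g n), although the norms of g n
     need not be bounded. *)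
  have bound: "norm (X (toeplitz \<phi> (g n)) z) \<le> norm (\<psi> z) * (K * C * hardy2_norm f)" for n
  proof -
    have "hardy2_norm (X (g n)) \<le> hardy2_norm (X (toeplitz \<phi> (g n)))"
      unfolding XT[OF g] by (rule hardy2_norm_inner_mult[OF \<psi> XH[OF g]])
    also have "\<dots> \<le> C * hardy2_norm f"
      using C(1)[OF Tg] mult_left_mono[OF le C(2)] by (rule order_trans)
    finally have "K * hardy2_norm (X (g n)) \<le> K * (C * hardy2_norm f)"
      by (rule mult_left_mono[OF _ K(2)])
    with K(1)[OF XH[OF g]] have "norm (X (g n) z) \<le> K * (C * hardy2_norm f)"
      by (rule order_trans)
    then show ?thesis
      by (subst XT[OF g]) (simp add: toeplitz_def norm_mult mult_left_mono mult.assoc)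
  qed
  have "(\<lambda>n. X (toeplitz \<phi> (g n)) z - X f z) \<longlonglongrightarrow> 0"
  proof (rule Lim_null_comparison)
    show "\<forall>\<^sub>F n in sequentially. norm (X (toeplitz \<phi> (g n)) z - X f z)
        \<le> K * (C * hardy2_norm (\<lambda>z. toeplitz \<phi> (g n) z - f z))"
    proof (intro always_eventually allI)
      fix n
      let ?d = "\<lambda>z. toeplitz \<phi> (g n) z - f z"
      have d: "?d \<in> hardy2" by (rule hardy2_diff[OF Tg f])
      have "norm (X ?d z) \<le> K * (C * hardy2_norm ?d)"
        using K(1)[OF XH[OF d]] mult_left_mono[OF C(1)[OF d] K(2)] by linarith
      then show "norm (X (toeplitz \<phi> (g n)) z - X f z) \<le> K * (C * hardy2_norm ?d)"
        by (simp add: bounded_operator_diff[OF X Tg f])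
    qed
    have "(\<lambda>n. K * (C * hardy2_norm (\<lambda>z. toeplitz \<phi> (g n) z - f z))) \<longlonglongrightarrow> K * (C * 0)"
      by (intro tendsto_intros lim)
    then show "(\<lambda>n. K * (C * hardy2_norm (\<lambda>z. toeplitz \<phi> (g n) z - f z))) \<longlonglongrightarrow> 0" by simp
  qed
  then have "(\<lambda>n. norm (X (toeplitz \<phi> (g n)) z)) \<longlonglongrightarrow> norm (X f z)"
    by (intro tendsto_norm) (rule LIM_zero_cancel)
  then show ?thesis
    by (rule LIMSEQ_le_const2) (use bound in auto)
qed

theorem proposition6p4:
  fixes \<phi> \<psi> :: "complex \<Rightarrow> complex"
  assumes "bounded_analytic \<phi>" and "bounded_analytic \<psi>"
    and "outer_function \<phi>"
    and "inner_function \<psi>" and "\<not> \<psi> constant_on \<U>"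
  shows "\<not> (toeplitz \<phi> \<propto> toeplitz \<psi>)"
proof
  assume "toeplitz \<phi> \<propto> toeplitz \<psi>"
  then obtain X f where X: "bounded_operator X" and f: "f \<in> hardy2" "X f \<noteq> (\<lambda>z. 0)"
    and XT: "\<And>f. f \<in> hardy2 \<Longrightarrow> X (toeplitz \<phi> f) = toeplitz \<psi> (X f)"
    unfolding intertwined_def by blast
  obtain C where C: "0 \<le> C" "\<And>f. f \<in> hardy2 \<Longrightarrow> hardy2_norm (X f) \<le> C * hardy2_norm f"
    using bounded_operator_norm_bound[OF X] by blast
  have "X f z = 0" for z
  proof (cases "z \<in> \<U>")
    case True
    obtain K where K: "0 \<le> K" "\<And>f. f \<in> hardy2 \<Longrightarrow> norm (f z) \<le> K * hardy2_norm f"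
      using hardy2_point_bound[OF True] by blast
    have "norm (X f z) \<le> norm (\<psi> z ^ n) * (K * C * hardy2_norm f)" for n
    proof (rule intertwining_point_bound[OF X _ bounded_analytic_power[OF assms(1)]
          outer_function_power[OF assms(3)] inner_function_power[OF assms(4)] f(1) _ C(1) _ K(1)])
      show "X (toeplitz (\<lambda>z. \<phi> z ^ n) f) = toeplitz (\<lambda>z. \<psi> z ^ n) (X f)" if "f \<in> hardy2" for f
        using XT assms(1) that by (rule intertwining_power)
    qed (fact C(2) K(2))+
    moreover have "(\<lambda>n. norm (\<psi> z ^ n) * (K * C * hardy2_norm f)) \<longlonglongrightarrow> 0 * (K * C * hardy2_norm f)"
      unfolding norm_power
      by (intro tendsto_intros LIMSEQ_power_zero)
         (use nonconstant_inner_function_norm_less_1[OF assms(4,5) True] in simp)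
    ultimately have "norm (X f z) \<le> 0"
      by (intro LIMSEQ_le_const[where X = "\<lambda>n. norm (\<psi> z ^ n) * (K * C * hardy2_norm f)"]) auto
    then show ?thesis by simp
  next
    case False
    have "X f \<in> hardy2" using X f(1) by (simp add: bounded_operator_def)
    then show ?thesis using False by (simp add: hardy2_def)
  qed
  with f(2) show False by auto
qed

end
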